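(* In the 1-sided False Positive regime, let the moldgraph $G$ be a planar graph with $m$ edges (with a fixed planar embedding) whose realized subgraph is a tree $T$. Consider the algorithm SolvePlanarFP: construct the dual graph $G^*$ of $G$; run SolveSparseFN on $G^*$, where a query on a dual edge is answered by querying the corresponding edge of $G$ and inverting the answer (``Yes'' becomes ``No'' and vice versa); let $F$ be the returned set of dual edges, and output $E(G)\setminus F$ (identifying dual edges with edges of $G$). Then SolvePlanarFP outputs the realized spanning tree $T$ with probability $1$ while performing $O(m)$ queries in expectation. Here SolveSparseFN$(H)$ is: if $H$ has a single vertex, return $\emptyset$; otherwise let $u$ be a vertex of minimum degree, let $N(u)$ be the collection of super-edges incident to $u$, let $e=\mathrm{DISCOVER}(N(u))$, contract $e$ to obtain $H'$, and return $\mathrm{SolveSparseFN}(H')\cup\{e\}$. DISCOVER$(\mathcal{S})$, for a collection $\mathcal{S}=\{E_1,\dots,E_k\}$ of edge sets each with a fixed cyclic order, repeats rounds; in each round, for $i=1,\dots,k$, it queries the next edge $e$ in the cyclic order of $E_i$ and returns $e$ if the (inverted) answer is ``Yes''.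
   Context: Problem (graph connectivity with noisy queries): a graph $G=(V,E)$, the moldgraph, with $n$ vertices and $m$ edges is given. An adversary selects a connected spanning subgraph of $G$ to be realized (here a spanning tree $T$). The algorithm may query an oracle on any edge $e$ (``Is $e$ realized?''), receiving ``Yes''/``No''; each query costs $1$; answers to distinct queries (including repeated queries of the same edge) are independent. In the 1-sided False Positive regime: for a realized edge the answer is always ``Yes''; for a non-realized edge the answer is ``Yes'' with a constant probability $p<1/2$ and ``No'' with probability $1-p$. The dual graph of a plane graph $G$ has one vertex per face of $G$ and, for each edge $e$ of $G$, one dual edge joining the (vertices of the) faces on the two sides of $e$; it may have parallel edges. Multigraph conventions: a super-edge is the set of all parallel edges between two vertices; $N(v)$ is the set of super-edges incident to $v$ and $\deg(v)=|N(v)|$; contracting $e=\{u,v\}$ merges $u,v$ into one vertex adjacent to all former neighbours of $u$ or $v$, deletes all edges parallel to $e$ (no self-loops), and merges super-edges that become parallel into one super-edge. *)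

theory Defs
  imports "HOL-Probability.Probability"
begin

section \<open>Plane (multi)graphs as combinatorial maps\<close>

text \<open>A plane embedding of a connected graph is given by a combinatorial map:
a finite set of darts D (two per edge), a fixed-point-free involution alpha
(the two darts of an edge) and a rotation sigma (cyclic order of darts around
each vertex).  Vertices are sigma-orbits, edges are alpha-orbits, faces are
orbits of sigma o alpha.  The map is planar (genus 0) iff V - E + F = 2.\<close>

definition orb :: "('a \<Rightarrow> 'a) \<Rightarrow> 'a \<Rightarrow> 'a set" where
  "orb f x = {(f ^^ n) x | n. True}"

definition is_map :: "'d set \<Rightarrow> ('d \<Rightarrow> 'd) \<Rightarrow> ('d \<Rightarrow> 'd) \<Rightarrow> bool" where
  "is_map D \<alpha> \<sigma> \<longleftrightarrow> finite D \<and> (\<forall>d\<in>D. \<alpha> d \<in> D \<and> \<alpha> d \<noteq> d \<and> \<alpha> (\<alpha> d) = d)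
     \<and> bij_betw \<sigma> D D"

definition map_edges :: "'d set \<Rightarrow> ('d \<Rightarrow> 'd) \<Rightarrow> 'd set set" where
  "map_edges D \<alpha> = (\<lambda>d. {d, \<alpha> d}) ` D"

definition map_verts :: "'d set \<Rightarrow> ('d \<Rightarrow> 'd) \<Rightarrow> 'd set set" where
  "map_verts D \<sigma> = orb \<sigma> ` D"

definition map_faces :: "'d set \<Rightarrow> ('d \<Rightarrow> 'd) \<Rightarrow> ('d \<Rightarrow> 'd) \<Rightarrow> 'd set set" where
  "map_faces D \<alpha> \<sigma> = orb (\<sigma> \<circ> \<alpha>) ` D"

definition map_connected :: "'d set \<Rightarrow> ('d \<Rightarrow> 'd) \<Rightarrow> ('d \<Rightarrow> 'd) \<Rightarrow> bool" where
  "map_connected D \<alpha> \<sigma> \<longleftrightarrow>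
     (\<forall>d\<in>D. \<forall>d'\<in>D. (d, d') \<in> ({(x, \<sigma> x) | x. x \<in> D} \<union> {(x, \<alpha> x) | x. x \<in> D})\<^sup>*)"

definition plane_map :: "'d set \<Rightarrow> ('d \<Rightarrow> 'd) \<Rightarrow> ('d \<Rightarrow> 'd) \<Rightarrow> bool" where
  "plane_map D \<alpha> \<sigma> \<longleftrightarrow> is_map D \<alpha> \<sigma> \<and> map_connected D \<alpha> \<sigma> \<and>
     int (card (map_verts D \<sigma>)) - int (card (map_edges D \<alpha>)) + int (card (map_faces D \<alpha> \<sigma>)) = 2"

text \<open>The underlying graph is simple: no loops and no parallel edges.\<close>
definition simple_map :: "'d set \<Rightarrow> ('d \<Rightarrow> 'd) \<Rightarrow> ('d \<Rightarrow> 'd) \<Rightarrow> bool" where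
  "simple_map D \<alpha> \<sigma> \<longleftrightarrow> (\<forall>d\<in>D. orb \<sigma> d \<noteq> orb \<sigma> (\<alpha> d)) \<and>
     (\<forall>d\<in>D. \<forall>d'\<in>D. orb \<sigma> d = orb \<sigma> d' \<and> orb \<sigma> (\<alpha> d) = orb \<sigma> (\<alpha> d')
        \<longrightarrow> {d, \<alpha> d} = {d', \<alpha> d'})"

text \<open>Spanning tree of the primal graph: a set of edges connecting all vertices
with exactly |V| - 1 edges.\<close>
definition spanning_tree :: "'d set \<Rightarrow> ('d \<Rightarrow> 'd) \<Rightarrow> ('d \<Rightarrow> 'd) \<Rightarrow> 'd set set \<Rightarrow> bool" where
  "spanning_tree D \<alpha> \<sigma> T \<longleftrightarrow> T \<subseteq> map_edges D \<alpha> \<and> card T + 1 = card (map_verts D \<sigma>) \<and>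
     (\<forall>u\<in>map_verts D \<sigma>. \<forall>v\<in>map_verts D \<sigma>.
        (u, v) \<in> {(orb \<sigma> d, orb \<sigma> (\<alpha> d)) | d. d \<in> D \<and> {d, \<alpha> d} \<in> T}\<^sup>*)"

section \<open>The dual graph and its contractions\<close>

text \<open>The dual edge of primal edge e joins the faces on the two sides of e.\<close>
definition dual_ends :: "('d \<Rightarrow> 'd) \<Rightarrow> ('d \<Rightarrow> 'd) \<Rightarrow> 'd set \<Rightarrow> 'd set set" where
  "dual_ends \<alpha> \<sigma> e = orb (\<sigma> \<circ> \<alpha>) ` e"

text \<open>Contracting the set F of dual edges: vertices of the contracted dual graph
are the classes of faces connected by edges of F.\<close>
definition dual_comp :: "'d set \<Rightarrow> ('d \<Rightarrow> 'd) \<Rightarrow> ('d \<Rightarrow> 'd) \<Rightarrow> 'd set set \<Rightarrow> 'd set \<Rightarrow> 'd set set" where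
  "dual_comp D \<alpha> \<sigma> F f = {g \<in> map_faces D \<alpha> \<sigma>. (f, g) \<in>
      {(orb (\<sigma> \<circ> \<alpha>) d, orb (\<sigma> \<circ> \<alpha>) (\<alpha> d)) | d. d \<in> D \<and> {d, \<alpha> d} \<in> F}\<^sup>*}"

definition dual_comps :: "'d set \<Rightarrow> ('d \<Rightarrow> 'd) \<Rightarrow> ('d \<Rightarrow> 'd) \<Rightarrow> 'd set set \<Rightarrow> 'd set set set" where
  "dual_comps D \<alpha> \<sigma> F = dual_comp D \<alpha> \<sigma> F ` map_faces D \<alpha> \<sigma>"

text \<open>Endpoints of a dual edge in the contracted graph.\<close>
definition cends :: "'d set \<Rightarrow> ('d \<Rightarrow> 'd) \<Rightarrow> ('d \<Rightarrow> 'd) \<Rightarrow> 'd set set \<Rightarrow> 'd set \<Rightarrow> 'd set set set" where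
  "cends D \<alpha> \<sigma> F e = dual_comp D \<alpha> \<sigma> F ` dual_ends \<alpha> \<sigma> e"

text \<open>Edges surviving in the contracted graph (self-loops are deleted).\<close>
definition rem_edges :: "'d set \<Rightarrow> ('d \<Rightarrow> 'd) \<Rightarrow> ('d \<Rightarrow> 'd) \<Rightarrow> 'd set set \<Rightarrow> 'd set set" where
  "rem_edges D \<alpha> \<sigma> F = {e \<in> map_edges D \<alpha>. card (cends D \<alpha> \<sigma> F e) = 2}"

text \<open>Super-edge: all parallel edges between two vertices of the contracted graph.\<close>
definition super_edge :: "'d set \<Rightarrow> ('d \<Rightarrow> 'd) \<Rightarrow> ('d \<Rightarrow> 'd) \<Rightarrow> 'd set set \<Rightarrow> 'd set set \<Rightarrow> 'd set set \<Rightarrow> 'd set set" where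
  "super_edge D \<alpha> \<sigma> F u w = {e \<in> rem_edges D \<alpha> \<sigma> F. cends D \<alpha> \<sigma> F e = {u, w}}"

definition nbhd :: "'d set \<Rightarrow> ('d \<Rightarrow> 'd) \<Rightarrow> ('d \<Rightarrow> 'd) \<Rightarrow> 'd set set \<Rightarrow> 'd set set \<Rightarrow> 'd set set set" where
  "nbhd D \<alpha> \<sigma> F u = {super_edge D \<alpha> \<sigma> F u w | w. w \<in> dual_comps D \<alpha> \<sigma> F \<and> w \<noteq> u
                        \<and> super_edge D \<alpha> \<sigma> F u w \<noteq> {}}"

definition cdeg :: "'d set \<Rightarrow> ('d \<Rightarrow> 'd) \<Rightarrow> ('d \<Rightarrow> 'd) \<Rightarrow> 'd set set \<Rightarrow> 'd set set \<Rightarrow> nat" where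
  "cdeg D \<alpha> \<sigma> F u = card (nbhd D \<alpha> \<sigma> F u)"

text \<open>A legal choice at state F (F = edges contracted so far): the list L
enumerates N(u) for a minimum-degree vertex u of the contracted dual graph,
each super-edge given as a list fixing its cyclic order.\<close>
definition valid_choice :: "'d set \<Rightarrow> ('d \<Rightarrow> 'd) \<Rightarrow> ('d \<Rightarrow> 'd) \<Rightarrow> 'd set set \<Rightarrow> 'd set list list \<Rightarrow> bool" where
  "valid_choice D \<alpha> \<sigma> F L \<longleftrightarrow> (\<exists>u\<in>dual_comps D \<alpha> \<sigma> F.
      (\<forall>v\<in>dual_comps D \<alpha> \<sigma> F. cdeg D \<alpha> \<sigma> F u \<le> cdeg D \<alpha> \<sigma> F v) \<and>
      distinct (map set L) \<and> set (map set L) = nbhd D \<alpha> \<sigma> F u \<and> (\<forall>l\<in>set L. distinct l))"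

definition valid_choices :: "'d set \<Rightarrow> ('d \<Rightarrow> 'd) \<Rightarrow> ('d \<Rightarrow> 'd) \<Rightarrow> ('d set set \<Rightarrow> 'd set list list) \<Rightarrow> bool" where
  "valid_choices D \<alpha> \<sigma> ch \<longleftrightarrow> (\<forall>F. F \<subseteq> map_edges D \<alpha> \<and> card (dual_comps D \<alpha> \<sigma> F) \<ge> 2
       \<longrightarrow> valid_choice D \<alpha> \<sigma> F (ch F))"

section \<open>The randomized process SolvePlanarFP\<close>

text \<open>Randomness: omega t is the answer noise of the t-th query overall
(True with probability p, independently).  The primal oracle on edge e at
query t answers Yes iff e is in T or omega t; the inverted (dual) answer is
Yes iff e is not in T and not omega t.\<close>

text \<open>q-th query (0-based) of DISCOVER on the list of super-edges L:
round q div k, super-edge q mod k.\<close>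
definition qedge :: "'e list list \<Rightarrow> nat \<Rightarrow> 'e" where
  "qedge L q = (let k = length L; l = L ! (q mod k) in l ! ((q div k) mod length l))"

definition dual_yes :: "'e set \<Rightarrow> (nat \<Rightarrow> bool) \<Rightarrow> nat \<Rightarrow> 'e \<Rightarrow> bool" where
  "dual_yes T \<omega> t e \<longleftrightarrow> e \<notin> T \<and> \<not> \<omega> t"

text \<open>One call of DISCOVER(N(u)) followed by the contraction: state (F, t) with F
the edges returned so far and t the number of queries made so far.
None means DISCOVER never returns.\<close>
definition fp_step :: "'e set \<Rightarrow> ('e set \<Rightarrow> 'e list list) \<Rightarrow> (nat \<Rightarrow> bool)
    \<Rightarrow> 'e set \<times> nat \<Rightarrow> ('e set \<times> nat) option" where
  "fp_step T ch \<omega> s = (let F = fst s; t = snd s; L = ch F in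
     if L \<noteq> [] \<and> (\<exists>q. dual_yes T \<omega> (t + q) (qedge L q)) then
       (let q = (LEAST q. dual_yes T \<omega> (t + q) (qedge L q)) in Some (F \<union> {qedge L q}, t + q + 1))
     else None)"

primrec fp_run :: "'d set \<Rightarrow> ('d \<Rightarrow> 'd) \<Rightarrow> ('d \<Rightarrow> 'd) \<Rightarrow> 'd set set \<Rightarrow> ('d set set \<Rightarrow> 'd set list list)
    \<Rightarrow> (nat \<Rightarrow> bool) \<Rightarrow> nat \<Rightarrow> ('d set set \<times> nat) option" where
  "fp_run D \<alpha> \<sigma> T ch \<omega> 0 = Some ({}, 0)"
| "fp_run D \<alpha> \<sigma> T ch \<omega> (Suc n) = (case fp_run D \<alpha> \<sigma> T ch \<omega> n of None \<Rightarrow> None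
     | Some s \<Rightarrow> if card (dual_comps D \<alpha> \<sigma> (fst s)) \<le> 1 then Some s else fp_step T ch \<omega> s)"

definition fp_done :: "'d set \<Rightarrow> ('d \<Rightarrow> 'd) \<Rightarrow> ('d \<Rightarrow> 'd) \<Rightarrow> 'd set set \<Rightarrow> ('d set set \<Rightarrow> 'd set list list)
    \<Rightarrow> (nat \<Rightarrow> bool) \<Rightarrow> nat \<Rightarrow> bool" where
  "fp_done D \<alpha> \<sigma> T ch \<omega> n \<longleftrightarrow> (\<exists>s. fp_run D \<alpha> \<sigma> T ch \<omega> n = Some s \<and>
       card (dual_comps D \<alpha> \<sigma> (fst s)) \<le> 1)"

definition fp_final :: "'d set \<Rightarrow> ('d \<Rightarrow> 'd) \<Rightarrow> ('d \<Rightarrow> 'd) \<Rightarrow> 'd set set \<Rightarrow> ('d set set \<Rightarrow> 'd set list list)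
    \<Rightarrow> (nat \<Rightarrow> bool) \<Rightarrow> 'd set set \<times> nat" where
  "fp_final D \<alpha> \<sigma> T ch \<omega> = the (fp_run D \<alpha> \<sigma> T ch \<omega> (LEAST n. fp_done D \<alpha> \<sigma> T ch \<omega> n))"

text \<open>Output E(G) minus F, or None if the algorithm does not terminate.\<close>
definition fp_output :: "'d set \<Rightarrow> ('d \<Rightarrow> 'd) \<Rightarrow> ('d \<Rightarrow> 'd) \<Rightarrow> 'd set set \<Rightarrow> ('d set set \<Rightarrow> 'd set list list)
    \<Rightarrow> (nat \<Rightarrow> bool) \<Rightarrow> 'd set set option" where
  "fp_output D \<alpha> \<sigma> T ch \<omega> = (if \<exists>n. fp_done D \<alpha> \<sigma> T ch \<omega> n
      then Some (map_edges D \<alpha> - fst (fp_final D \<alpha> \<sigma> T ch \<omega>)) else None)"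

text \<open>Total number of queries (infinite if the algorithm does not terminate).\<close>
definition fp_queries :: "'d set \<Rightarrow> ('d \<Rightarrow> 'd) \<Rightarrow> ('d \<Rightarrow> 'd) \<Rightarrow> 'd set set \<Rightarrow> ('d set set \<Rightarrow> 'd set list list)
    \<Rightarrow> (nat \<Rightarrow> bool) \<Rightarrow> ennreal" where
  "fp_queries D \<alpha> \<sigma> T ch \<omega> = (if \<exists>n. fp_done D \<alpha> \<sigma> T ch \<omega> n
      then of_nat (snd (fp_final D \<alpha> \<sigma> T ch \<omega>)) else \<infinity>)"

text \<open>Probability space of the noise: i.i.d. Bernoulli(p) bits.\<close>
definition noise :: "real \<Rightarrow> (nat \<Rightarrow> bool) measure" where
  "noise p = PiM UNIV (\<lambda>_. measure_pmf (bernoulli_pmf p))"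

end

theory Submission
  imports Defs
begin

text \<open>The dual of the complement of a spanning tree is a spanning tree of the dual graph, so every
  cut of a contracted dual graph contains an edge outside \<open>T\<close>, and a cycle-free set of discovered
  edges that connects all faces must be \<open>E - T\<close>. Both this and the degree bound rest on one observation:
  inserting an edge into a map composes its face permutation with a transposition, which
  changes the number of cycles by at most one, and merges two cycles if the edge joins different
  components.
  By Euler's formula the simple graph underlying a contracted dual graph then has a vertex of
  degree at most 5.

  For the cost, let \<open>s\<close> be the size of the smallest super-edge at \<open>u\<close> that contains an edge outside
  \<open>T\<close>. That edge is queried once in every \<open>5 s\<close> queries, so DISCOVER takes at most \<open>5 s / (1 - p)\<close>
  queries in expectation, while whichever edge it returns, the contraction deletes at least \<open>s\<close>
  of the \<open>m\<close> dual edges. The total is thus at most \<open>5 m / (1 - p)\<close>; in particular the algorithm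
  terminates almost surely.\<close>

section \<open>Classes of generated equivalence relations\<close>

text \<open>Vertices, faces and components are all counted as classes of relations on darts, so that
  joining by an edge amounts to adding one generating pair.\<close>

definition symcl :: "('a \<times> 'a) set \<Rightarrow> ('a \<times> 'a) set" where
  "symcl r = (r \<union> r\<inverse>)\<^sup>*"

lemma symcl_refl [simp]: "(x, x) \<in> symcl r"
  by (simp add: symcl_def)

lemma symcl_sym: "(x, y) \<in> symcl r \<Longrightarrow> (y, x) \<in> symcl r"
proof -
  have "sym (symcl r)"
    unfolding symcl_def by (intro sym_rtrancl) (auto simp: sym_def)
  then show "(x, y) \<in> symcl r \<Longrightarrow> (y, x) \<in> symcl r"
    by (auto dest: symD)
qed

lemma symcl_trans: "(x, y) \<in> symcl r \<Longrightarrow> (y, z) \<in> symcl r \<Longrightarrow> (x, z) \<in> symcl r"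
  unfolding symcl_def by (rule rtrancl_trans)

lemma symcl_base: "(x, y) \<in> r \<Longrightarrow> (x, y) \<in> symcl r"
  by (auto simp: symcl_def)

lemma symcl_induct [consumes 1, case_names refl step]:
  assumes "(x, y) \<in> symcl r" "P x"
    "\<And>y z. (x, y) \<in> symcl r \<Longrightarrow> (y, z) \<in> r \<or> (z, y) \<in> r \<Longrightarrow> P y \<Longrightarrow> P z"
  shows "P y"
  using assms(1) unfolding symcl_def
  by (induction rule: rtrancl_induct) (use assms in \<open>auto simp: symcl_def\<close>)

lemma symcl_Image_eq_iff: "symcl r `` {x} = symcl r `` {y} \<longleftrightarrow> (x, y) \<in> symcl r"
proof
  assume "symcl r `` {x} = symcl r `` {y}"
  then show "(x, y) \<in> symcl r" by (auto simp: set_eq_iff)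
next
  assume "(x, y) \<in> symcl r"
  then show "symcl r `` {x} = symcl r `` {y}"
    by (auto dest: symcl_trans dest: symcl_trans[OF symcl_sym])
qed

text \<open>Turns relatedness into an equation, on which the simplifier does the equivalence reasoning.\<close>

lemmas symcl_iff = symcl_Image_eq_iff[symmetric]

lemma symcl_least: 
  assumes "r \<subseteq> symcl s" shows "symcl r \<subseteq> symcl s"
proof (rule subrelI)
  fix x y assume "(x, y) \<in> symcl r"
  then show "(x, y) \<in> symcl s"
    by (induction rule: symcl_induct) (use assms in \<open>auto intro: symcl_trans symcl_sym\<close>)
qed

lemma symcl_mono: "r \<subseteq> s \<Longrightarrow> symcl r \<subseteq> symcl s"
  by (rule symcl_least) (auto intro: symcl_base)

lemma symcl_Un_cong:
  assumes "symcl r = symcl s" shows "symcl (r \<union> t) = symcl (s \<union> t)"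
proof -
  have *: "symcl (r \<union> t) \<subseteq> symcl (s \<union> t)" if "symcl r = symcl s" for r s :: "('a \<times> 'a) set"
  proof (rule symcl_least)
    have "r \<subseteq> symcl s" using that symcl_base by fastforce
    also have "\<dots> \<subseteq> symcl (s \<union> t)" by (rule symcl_mono) simp
    finally show "r \<union> t \<subseteq> symcl (s \<union> t)" by (auto intro: symcl_base)
  qed
  from *[OF assms] *[OF assms[symmetric]] show ?thesis by simp
qed

text \<open>A chain can be shortened until it uses the new pair at most once, in one of its two
  directions.\<close>

lemma symcl_insert_iff:
  "(a, b) \<in> symcl (insert (x, y) r) \<longleftrightarrow> (a, b) \<in> symcl r \<or>
     (a, x) \<in> symcl r \<and> (y, b) \<in> symcl r \<or> (a, y) \<in> symcl r \<and> (x, b) \<in> symcl r"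
    (is "?l \<longleftrightarrow> ?r")
proof
  assume ?l
  then show ?r
  proof (induction rule: symcl_induct)
    case (step b c)
    have "(b, c) \<in> symcl r \<or> (b, c) = (x, y) \<or> (c, b) = (x, y)"
      using step.hyps(2) by (auto intro: symcl_base symcl_sym)
    with step.IH show ?case
      unfolding symcl_iff by auto
  qed auto
next
  have m: "(u, v) \<in> symcl (insert (x, y) r)" if "(u, v) \<in> symcl r" for u v
    using symcl_mono[of r "insert (x, y) r"] that by auto
  have xy: "(x, y) \<in> symcl (insert (x, y) r)" by (simp add: symcl_base)
  assume ?r
  then show ?l
    by (meson m xy symcl_trans symcl_sym)
qed

lemma symcl_insert_related:
  "(x, y) \<in> symcl r \<Longrightarrow> symcl (insert (x, y) r) = symcl r"
  by (auto simp: symcl_insert_iff) (auto simp: symcl_iff[of _ _ r])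

section \<open>Counting equivalence classes\<close>

lemma quotient_eq_image: "D // symcl r = (\<lambda>x. symcl r `` {x}) ` D"
  by (auto simp: quotient_def)

text \<open>The classes of \<open>x\<close> and \<open>y\<close> fuse into one and all others are
  unchanged.\<close>

lemma card_quotient_insert:
  assumes "finite D" "x \<in> D" "y \<in> D" "(x, y) \<notin> symcl r"
  shows "card (D // symcl (insert (x, y) r)) + 1 = card (D // symcl r)"
proof -
  let ?R = "symcl r" and ?R' = "symcl (insert (x, y) r)"
  let ?X = "?R `` {x}" and ?Y = "?R `` {y}"
  have cls: "?R' `` {a} = (if a \<in> ?X \<union> ?Y then ?X \<union> ?Y else ?R `` {a})" for a
  proof -
    have "(a, z) \<in> ?R' \<longleftrightarrow> (if (x, a) \<in> ?R \<or> (y, a) \<in> ?R then (x, z) \<in> ?R \<or> (y, z) \<in> ?R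
        else (a, z) \<in> ?R)" for z
      unfolding symcl_insert_iff symcl_iff[of _ _ r] by metis
    then show ?thesis by (simp add: set_eq_iff)
  qed
  have "D // ?R' = insert (?X \<union> ?Y) (D // ?R - {?X, ?Y})" (is "?l = ?r")
  proof
    show "?l \<subseteq> ?r"
    proof
      fix C assume "C \<in> ?l"
      then obtain a where a: "a \<in> D" "C = ?R' `` {a}" by (auto simp: quotient_eq_image)
      show "C \<in> ?r"
      proof (cases "a \<in> ?X \<union> ?Y")
        case True
        then show ?thesis using a(2) cls[of a] by simp
      next
        case False
        have "a \<in> ?R `` {a}" by simp
        with False a cls[of a] have "C = ?R `` {a}" "C \<noteq> ?X" "C \<noteq> ?Y" by auto
        with a(1) show ?thesis unfolding quotient_eq_image by blast
      qed
    qed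
    show "?r \<subseteq> ?l"
    proof
      fix C assume "C \<in> ?r"
      then consider "C = ?X \<union> ?Y" | a where "a \<in> D" "C = ?R `` {a}" "C \<noteq> ?X" "C \<noteq> ?Y"
        by (auto simp: quotient_eq_image)
      then show "C \<in> ?l"
      proof cases
        case 1
        then have "C = ?R' `` {x}" using cls[of x] by simp
        with assms(2) show ?thesis unfolding quotient_eq_image by blast
      next
        case 2
        then have "a \<notin> ?X \<union> ?Y" using symcl_Image_eq_iff[of r x a] symcl_Image_eq_iff[of r y a] by auto
        with 2 cls[of a] have "C = ?R' `` {a}" by auto
        with 2(1) show ?thesis unfolding quotient_eq_image by blast
      qed
    qed
  qed
  \<comment> \<open>The fused class must be new for the count of two removed, one added; as an old
    class it would relate \<open>x\<close> to \<open>y\<close>.\<close>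
  moreover have "?X \<union> ?Y \<notin> D // ?R - {?X, ?Y}"
  proof
    assume "?X \<union> ?Y \<in> D // ?R - {?X, ?Y}"
    then obtain a where a: "?X \<union> ?Y = ?R `` {a}" by (auto simp: quotient_eq_image)
    have "x \<in> ?X \<union> ?Y" "y \<in> ?X \<union> ?Y" by auto
    with a have "(a, x) \<in> ?R" "(a, y) \<in> ?R" by auto
    with assms(4) show False by (meson symcl_trans symcl_sym)
  qed
  moreover have "?X \<noteq> ?Y" using assms(4) by (simp add: symcl_Image_eq_iff)
  moreover have "?X \<in> D // ?R" "?Y \<in> D // ?R" using assms by (auto simp: quotient_eq_image)
  moreover have fin: "finite (D // ?R)" using assms(1) by (simp add: quotient_eq_image)
  moreover have "card {?X, ?Y} \<le> card (D // ?R)"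
    using calculation by (intro card_mono) auto
  ultimately show ?thesis
    by (simp add: card_Diff_subset)
qed

lemma card_quotient_insert_ge:
  assumes "finite D" "x \<in> D" "y \<in> D"
  shows "card (D // symcl r) \<le> card (D // symcl (insert (x, y) r)) + 1"
  using card_quotient_insert[OF assms, of r] symcl_insert_related[of x y r]
  by (cases "(x, y) \<in> symcl r") auto

text \<open>Sending each class of the finer relation to the coarser class around it is onto.\<close>

lemma card_quotient_mono:
  assumes "finite D" "symcl r \<subseteq> symcl s"
  shows "card (D // symcl s) \<le> card (D // symcl r)"
proof -
  have "D // symcl s = (\<lambda>C. symcl s `` C) ` (D // symcl r)"
  proof -
    have "symcl s `` {x} = symcl s `` (symcl r `` {x})" for x
    proof
      show "symcl s `` (symcl r `` {x}) \<subseteq> symcl s `` {x}"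
        using assms(2) by (auto dest: symcl_trans)
    qed auto
    then show ?thesis unfolding quotient_eq_image image_image by auto
  qed
  then show ?thesis
    using assms(1) by (auto simp: quotient_eq_image intro!: card_image_le)
qed

lemma sum_card_classes:
  assumes "finite D" "S \<subseteq> D"
  shows "(\<Sum>C\<in>D // symcl r. card (S \<inter> C)) = card S"
proof -
  have "S = (\<Union>C\<in>D // symcl r. S \<inter> C)"
    using assms(2) by (auto simp: quotient_eq_image)
  moreover have "card (\<Union>C\<in>D // symcl r. S \<inter> C) = (\<Sum>C\<in>D // symcl r. card (S \<inter> C))"
  proof (rule card_UN_disjoint)
    show "finite (D // symcl r)" using assms(1) by (simp add: quotient_eq_image)
    show "\<forall>C\<in>D // symcl r. finite (S \<inter> C)" using assms finite_subset by blast
    show "\<forall>C\<in>D // symcl r. \<forall>C'\<in>D // symcl r. C \<noteq> C' \<longrightarrow> S \<inter> C \<inter> (S \<inter> C') = {}"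
      unfolding quotient_eq_image by (auto simp: symcl_iff)
  qed
  ultimately show ?thesis by simp
qed

section \<open>Orbits of permutations\<close>

definition dgraph :: "'a set \<Rightarrow> ('a \<Rightarrow> 'a) \<Rightarrow> ('a \<times> 'a) set" where
  "dgraph D f = (\<lambda>x. (x, f x)) ` D"

lemma dgraph_cong: "(\<And>x. x \<in> D \<Longrightarrow> f x = g x) \<Longrightarrow> dgraph D f = dgraph D g"
  by (auto simp: dgraph_def)

lemma orb_refl: "x \<in> orb f x"
  unfolding orb_def by (auto intro: exI[of _ 0])

lemma orb_step: "y \<in> orb f x \<Longrightarrow> f y \<in> orb f x"
  unfolding orb_def by (auto intro: exI[of _ "Suc _"])

lemma orb_least:
  assumes "x \<in> X" "\<And>y. y \<in> X \<Longrightarrow> f y \<in> X" shows "orb f x \<subseteq> X"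
proof -
  have "(f ^^ n) x \<in> X" for n by (induction n) (use assms in auto)
  then show ?thesis by (auto simp: orb_def)
qed

text \<open>Forward orbits absorb backward steps: an injection of a finite orbit into itself is
  onto, so the preimage of an orbit point lies in the orbit.\<close>

lemma symcl_dgraph_Image:
  assumes "finite D" "bij_betw f D D" "x \<in> D"
  shows "symcl (dgraph D f) `` {x} = orb f x"
proof
  have sub: "orb f x \<subseteq> D"
    using assms by (intro orb_least) (auto simp: bij_betw_def)
  have surj: "f ` orb f x = orb f x"
    using finite_subset[OF sub assms(1)]
  proof (rule endo_inj_surj)
    show "inj_on f (orb f x)" using assms(2) sub by (auto simp: bij_betw_def inj_on_subset)
  qed (auto simp: orb_step)
  show "symcl (dgraph D f) `` {x} \<subseteq> orb f x"
  proof clarsimp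
    fix y assume "(x, y) \<in> symcl (dgraph D f)"
    then show "y \<in> orb f x"
    proof (induction rule: symcl_induct)
      case refl then show ?case by (rule orb_refl)
    next
      case (step y z)
      show ?case
      proof (cases "(y, z) \<in> dgraph D f")
        case True then show ?thesis using step by (auto simp: dgraph_def orb_step)
      next
        case False
        with step have z: "z \<in> D" "f z = y" by (auto simp: dgraph_def)
        have "y \<in> f ` orb f x" unfolding surj by (rule step.IH)
        then obtain z' where z': "z' \<in> orb f x" "f z' = y" by (elim imageE) simp
        then have "z' = z" 
          using z sub assms(2) by (auto simp: bij_betw_def dest: inj_onD)
        with z' show ?thesis by simp
      qed
    qed
  qed
  show "orb f x \<subseteq> symcl (dgraph D f) `` {x}"
  proof -
    have "orb f x \<subseteq> D \<inter> symcl (dgraph D f) `` {x}"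
    proof (rule orb_least)
      fix y assume y: "y \<in> D \<inter> symcl (dgraph D f) `` {x}"
      then have "(y, f y) \<in> symcl (dgraph D f)" by (auto simp: dgraph_def intro: symcl_base)
      with y assms(2) show "f y \<in> D \<inter> symcl (dgraph D f) `` {x}"
        by (auto simp: bij_betw_def dest: symcl_trans)
    qed (use assms(3) in auto)
    then show ?thesis by simp
  qed
qed

lemma orb_eq_iff:
  assumes "finite D" "bij_betw f D D" "x \<in> D" "y \<in> D"
  shows "orb f x = orb f y \<longleftrightarrow> (x, y) \<in> symcl (dgraph D f)"
  using assms by (simp flip: symcl_dgraph_Image[OF assms(1,2)] add: symcl_Image_eq_iff)

lemma card_orbits:
  assumes "finite D" "bij_betw f D D"
  shows "card (orb f ` D) = card (D // symcl (dgraph D f))"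
  using symcl_dgraph_Image[OF assms] by (simp add: quotient_eq_image)

section \<open>Composing a permutation with a transposition\<close>

lemma symcl_swap_subset:
  assumes "x \<in> D" "y \<in> D" "g' x = g y" "g' y = g x" 
    "\<And>z. z \<in> D \<Longrightarrow> z \<noteq> x \<Longrightarrow> z \<noteq> y \<Longrightarrow> g' z = g z"
  shows "symcl (insert (x, y) (dgraph D g')) \<subseteq> symcl (insert (x, y) (dgraph D g))"
proof (rule symcl_least)
  let ?R = "symcl (insert (x, y) (dgraph D g))"
  have xy: "(x, y) \<in> ?R" "(y, x) \<in> ?R" by (auto intro: symcl_base symcl_sym)
  have st: "(z, g z) \<in> ?R" if "z \<in> D" for z
    using that by (auto intro: symcl_base simp: dgraph_def)
  have "(z, g' z) \<in> ?R" if "z \<in> D" for z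
    using assms xy st that by (metis symcl_trans)
  then show "insert (x, y) (dgraph D g') \<subseteq> ?R"
    using xy by (auto simp: dgraph_def)
qed

text \<open>\<open>g'\<close> is \<open>g\<close> after the exchange of \<open>x\<close> and
  \<open>y\<close>, so a step of one permutation is a step of the other, preceded at
  \<open>x\<close> and \<open>y\<close> by the pair \<open>(x, y)\<close> or its reverse.\<close>

lemma symcl_swap:
  assumes "x \<in> D" "y \<in> D" "g' x = g y" "g' y = g x" 
    "\<And>z. z \<in> D \<Longrightarrow> z \<noteq> x \<Longrightarrow> z \<noteq> y \<Longrightarrow> g' z = g z"
  shows "symcl (insert (x, y) (dgraph D g')) = symcl (insert (x, y) (dgraph D g))"
  using symcl_swap_subset[of x D y g' g] symcl_swap_subset[of x D y g g'] assms by auto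

text \<open>Both sides are compared with the common relation in which \<open>x\<close> and
  \<open>y\<close> are identified: this costs \<open>g'\<close> at most one class and gives
  \<open>g\<close> no new one.\<close>

lemma card_orbits_swap:
  assumes "finite D" "x \<in> D" "y \<in> D" "g' x = g y" "g' y = g x" 
    "\<And>z. z \<in> D \<Longrightarrow> z \<noteq> x \<Longrightarrow> z \<noteq> y \<Longrightarrow> g' z = g z"
  shows "card (D // symcl (dgraph D g')) \<le> card (D // symcl (dgraph D g)) + 1"
proof -
  have "card (D // symcl (dgraph D g')) \<le> card (D // symcl (insert (x, y) (dgraph D g'))) + 1"
    by (rule card_quotient_insert_ge) fact+
  also have "\<dots> = card (D // symcl (insert (x, y) (dgraph D g))) + 1"
    using symcl_swap[of x D y g' g] assms by simp
  also have "\<dots> \<le> card (D // symcl (dgraph D g)) + 1"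
    using assms(1) by (intro add_right_mono card_quotient_mono symcl_mono) auto
  finally show ?thesis .
qed

lemma symcl_swap_merge:
  assumes "finite D" "bij_betw g D D" "x \<in> D" "y \<in> D" "g' x = g y" "g' y = g x" 
    "\<And>z. z \<in> D \<Longrightarrow> z \<noteq> x \<Longrightarrow> z \<noteq> y \<Longrightarrow> g' z = g z"
    and nxy: "(x, y) \<notin> symcl (dgraph D g)"
  shows "symcl (dgraph D g') = symcl (insert (x, y) (dgraph D g))"
proof -
  let ?R' = "symcl (dgraph D g')"
  have "(x, y) \<in> ?R'"
  proof (rule ccontr)
    assume n: "(x, y) \<notin> ?R'"
    \<comment> \<open>Under the assumption \<open>n\<close>, neither \<open>x\<close> nor
      \<open>y\<close> lies in \<open>?W\<close>, so \<open>g\<close> and \<open>g'\<close> agree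
      there and \<open>?W\<close> is closed under \<open>g\<close>. But the cycle of
      \<open>g y\<close> contains \<open>y\<close>.\<close>
    let ?W = "{z \<in> D. (y, z) \<in> symcl (dgraph D g) \<and> (x, z) \<in> ?R'}"
    have gD: "z \<in> D \<Longrightarrow> g z \<in> D" for z using assms(2) by (auto simp: bij_betw_def)
    have stg: "z \<in> D \<Longrightarrow> (z, g z) \<in> symcl (dgraph D g)" for z
      by (auto intro: symcl_base simp: dgraph_def)
    have stg': "z \<in> D \<Longrightarrow> (z, g' z) \<in> ?R'" for z
      by (auto intro: symcl_base simp: dgraph_def)
    have "orb g (g y) \<subseteq> ?W"
    proof (rule orb_least)
      show "g y \<in> ?W" using gD stg stg'[of x] assms by auto
    next
      fix z assume z: "z \<in> ?W"
      then have "z \<noteq> y" "z \<noteq> x" using n nxy by (auto dest: symcl_sym)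
      with z assms have "g' z = g z" by auto
      with z gD[of z] stg[of z] stg'[of z] show "g z \<in> ?W" by (auto dest: symcl_trans)
    qed
    moreover have "y \<in> orb g (g y)"
      using symcl_dgraph_Image[OF assms(1,2) gD[OF assms(4)]] stg[OF assms(4)] 
      by (auto dest: symcl_sym)
    ultimately show False using n by auto
  qed
  then have "?R' = symcl (insert (x, y) (dgraph D g'))"
    by (simp add: symcl_insert_related)
  also have "\<dots> = symcl (insert (x, y) (dgraph D g))"
    using symcl_swap[of x D y g' g] assms by simp
  finally show ?thesis .
qed

section \<open>Dart systems and forests\<close>

locale dart_system =
  fixes D :: "'d set" and \<alpha> :: "'d \<Rightarrow> 'd"
  assumes finite_D: "finite D"
    and inv_in: "d \<in> D \<Longrightarrow> \<alpha> d \<in> D"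
    and inv_neq: "d \<in> D \<Longrightarrow> \<alpha> d \<noteq> d"
    and inv_inv: "d \<in> D \<Longrightarrow> \<alpha> (\<alpha> d) = d"
begin

abbreviation E :: "'d set set" where "E \<equiv> map_edges D \<alpha>"

definition darts :: "'d set set \<Rightarrow> 'd set" where
  "darts X = {d \<in> D. {d, \<alpha> d} \<in> X}"

text \<open>The relation generated by the orbits of \<open>f\<close> after gluing the two darts of every edge in
  \<open>X\<close>: for \<open>f = \<sigma>\<close> its classes are the components of the primal graph with edge set \<open>X\<close>, for
  \<open>f = \<sigma> \<circ> \<alpha>\<close> those of the dual graph.\<close>

definition conn :: "('d \<Rightarrow> 'd) \<Rightarrow> 'd set set \<Rightarrow> ('d \<times> 'd) set" where
  "conn f X = symcl (dgraph D f \<union> (\<lambda>d. (d, \<alpha> d)) ` darts X)"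

text \<open>The face permutation of the submap with edge set \<open>X\<close>. The darts of the deleted edges are
  kept as marks on the corners, so that an isolated vertex still has a face.\<close>

definition twist :: "'d set set \<Rightarrow> ('d \<Rightarrow> 'd) \<Rightarrow> 'd \<Rightarrow> 'd" where
  "twist X f d = f (if {d, \<alpha> d} \<in> X then \<alpha> d else d)"

text \<open>Acyclicity by counting: every edge of \<open>X\<close> lowers the number of components
  by one.\<close>

definition forest :: "('d \<Rightarrow> 'd) \<Rightarrow> 'd set set \<Rightarrow> bool" where
  "forest f X \<longleftrightarrow> X \<subseteq> E \<and> card (D // conn f X) + card X = card (D // conn f {})"

lemma bij_inv: "bij_betw \<alpha> D D"
  by (intro bij_betw_byWitness[where f' = \<alpha>]) (auto simp: inv_in inv_inv)

lemma edge_inv: "d \<in> D \<Longrightarrow> {\<alpha> d, \<alpha> (\<alpha> d)} = {d, \<alpha> d}"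
  using inv_inv by auto

lemma edge_eq_iff: "d \<in> D \<Longrightarrow> x \<in> D \<Longrightarrow> {x, \<alpha> x} = {d, \<alpha> d} \<longleftrightarrow> x = d \<or> x = \<alpha> d"
  using inv_inv by (auto simp: doubleton_eq_iff)

lemma finite_E: "finite E"
  using finite_D by (simp add: map_edges_def)

lemma edgeE: assumes "e \<in> E" obtains d where "d \<in> D" "e = {d, \<alpha> d}"
  using assms by (auto simp: map_edges_def)

lemma edge_in_E: "d \<in> D \<Longrightarrow> {d, \<alpha> d} \<in> E"
  by (auto simp: map_edges_def)

lemma conn_trans: "(x, y) \<in> conn f X \<Longrightarrow> (y, z) \<in> conn f X \<Longrightarrow> (x, z) \<in> conn f X"
  unfolding conn_def by (rule symcl_trans)

lemma conn_sym: "(x, y) \<in> conn f X \<Longrightarrow> (y, x) \<in> conn f X"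
  unfolding conn_def by (rule symcl_sym)

lemma conn_refl [simp]: "(x, x) \<in> conn f X"
  unfolding conn_def by simp

lemma conn_Image_eq_iff: "conn f X `` {x} = conn f X `` {y} \<longleftrightarrow> (x, y) \<in> conn f X"
  unfolding conn_def by (rule symcl_Image_eq_iff)

lemma conn_step: "d \<in> D \<Longrightarrow> (d, f d) \<in> conn f X"
  unfolding conn_def by (rule symcl_base) (auto simp: dgraph_def)

lemma conn_link: "d \<in> D \<Longrightarrow> {d, \<alpha> d} \<in> X \<Longrightarrow> (d, \<alpha> d) \<in> conn f X"
  unfolding conn_def by (rule symcl_base) (auto simp: darts_def)

lemma conn_empty: "conn f {} = symcl (dgraph D f)"
  by (simp add: conn_def darts_def)

lemma conn_mono: "X \<subseteq> Y \<Longrightarrow> conn f X \<subseteq> conn f Y"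
  unfolding conn_def by (rule symcl_mono) (auto simp: darts_def)

text \<open>The edge contributes a pair for each of its two darts; by symmetry one suffices, so that
  the one-pair counting lemmas apply.\<close>

lemma conn_insert:
  assumes "d \<in> D"
  shows "conn f (insert {d, \<alpha> d} X) = symcl (insert (d, \<alpha> d) (dgraph D f \<union> (\<lambda>d. (d, \<alpha> d)) ` darts X))"
    (is "?l = symcl ?r")
proof -
  have "darts (insert {d, \<alpha> d} X) = insert d (insert (\<alpha> d) (darts X))"
    using assms inv_in edge_eq_iff[OF assms] by (auto simp: darts_def)
  then have "?l = symcl (insert (\<alpha> d, d) ?r)"
    using assms by (simp add: conn_def inv_inv insert_commute)
  also have "\<dots> = symcl ?r"
    by (rule symcl_insert_related) (auto intro: symcl_sym symcl_base)
  finally show ?thesis .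
qed

lemma card_conn_insert_ge:
  "d \<in> D \<Longrightarrow> card (D // conn f X) \<le> card (D // conn f (insert {d, \<alpha> d} X)) + 1"
  unfolding conn_insert unfolding conn_def
  by (rule card_quotient_insert_ge) (auto simp: finite_D inv_in)

lemma card_conn_insert_eq:
  "d \<in> D \<Longrightarrow> (d, \<alpha> d) \<notin> conn f X \<Longrightarrow> card (D // conn f (insert {d, \<alpha> d} X)) + 1 = card (D // conn f X)"
  unfolding conn_insert unfolding conn_def
  by (rule card_quotient_insert) (auto simp: finite_D inv_in)

lemma conn_insert_related:
  "d \<in> D \<Longrightarrow> (d, \<alpha> d) \<in> conn f X \<Longrightarrow> conn f (insert {d, \<alpha> d} X) = conn f X"
  unfolding conn_insert unfolding conn_def by (rule symcl_insert_related)

lemma card_conn_ge: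
  assumes "X \<subseteq> E" shows "card (D // conn f {}) \<le> card (D // conn f X) + card X"
proof -
  have "finite X" using assms finite_E finite_subset by blast
  then show ?thesis using assms
  proof (induction X)
    case (insert e X)
    then obtain d where "d \<in> D" "e = {d, \<alpha> d}" by (auto elim: edgeE)
    with insert card_conn_insert_ge[of d f X] show ?case by simp
  qed simp
qed

text \<open>No edge lowers the count by more than one, so equality for the larger set forces every
  single edge to lower it by exactly one.\<close>

lemma forest_insertD:
  assumes "forest f (insert {d, \<alpha> d} X)" "{d, \<alpha> d} \<notin> X" "d \<in> D"
  shows "forest f X" "(d, \<alpha> d) \<notin> conn f X"
proof -
  have X: "X \<subseteq> E" using assms by (auto simp: forest_def)
  then have "finite X" using finite_E finite_subset by blast
  with assms have eq: "card (D // conn f (insert {d, \<alpha> d} X)) + card X + 1 = card (D // conn f {})"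
    by (simp add: forest_def)
  then show rel: "(d, \<alpha> d) \<notin> conn f X"
    using card_conn_ge[OF X, of f] conn_insert_related[OF assms(3), of f X] by auto
  show "forest f X"
    using X eq card_conn_insert_eq[OF assms(3) rel] by (simp add: forest_def)
qed

lemma forest_insertI:
  assumes "forest f X" "d \<in> D" "(d, \<alpha> d) \<notin> conn f X"
  shows "forest f (insert {d, \<alpha> d} X)"
proof -
  have X: "X \<subseteq> E" using assms by (auto simp: forest_def)
  then have "finite X" using finite_E finite_subset by blast
  moreover have "{d, \<alpha> d} \<notin> X" using assms conn_link by blast
  ultimately show ?thesis
    using assms X card_conn_insert_eq[OF assms(2,3)] by (auto simp: forest_def edge_in_E)
qed

section \<open>Face permutations of submaps\<close>

lemma bij_twist:
  assumes "bij_betw f D D" shows "bij_betw (twist X f) D D"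
proof -
  let ?i = "\<lambda>d. if {d, \<alpha> d} \<in> X then \<alpha> d else d"
  have "{\<alpha> d, d} \<in> X \<longleftrightarrow> {d, \<alpha> d} \<in> X" for d by (simp add: insert_commute)
  then have "bij_betw ?i D D"
    by (intro bij_betw_byWitness[where f' = ?i]) (auto simp: inv_in inv_inv)
  moreover have "twist X f = f \<circ> ?i" by (auto simp: twist_def)
  ultimately show ?thesis using assms by (auto intro: bij_betw_trans)
qed

lemma twist_insert:
  assumes "d \<in> D" "{d, \<alpha> d} \<notin> X"
  shows "twist (insert {d, \<alpha> d} X) f d = twist X f (\<alpha> d)"
    and "twist (insert {d, \<alpha> d} X) f (\<alpha> d) = twist X f d"
    and "z \<in> D \<Longrightarrow> z \<noteq> d \<Longrightarrow> z \<noteq> \<alpha> d \<Longrightarrow> twist (insert {d, \<alpha> d} X) f z = twist X f z"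
  using assms edge_inv[OF assms(1)] edge_eq_iff[OF assms(1), of z]
  by (auto simp: twist_def inv_inv)

text \<open>A forest has one face per component: each added edge joins two components, hence its
  transposition merges two cycles.\<close>

lemma forest_twist:
  assumes "bij_betw f D D" "forest f X"
  shows "symcl (dgraph D (twist X f)) = conn f X"
proof -
  have "X \<subseteq> E" using assms by (simp add: forest_def)
  then have "finite X" using finite_E finite_subset by blast
  then show ?thesis using assms(2)
  proof (induction X)
    case empty
    have "twist {} f = f" by (auto simp: twist_def)
    then show ?case by (simp add: conn_empty)
  next
    case (insert e X)
    from insert.prems obtain d where d: "d \<in> D" "e = {d, \<alpha> d}"
      by (auto simp: forest_def elim: edgeE)
    note fo = forest_insertD[OF insert.prems[unfolded d] _ d(1)]
    have IH: "symcl (dgraph D (twist X f)) = conn f X" using insert fo d by auto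
    have "symcl (dgraph D (twist (insert e X) f)) = symcl (insert (d, \<alpha> d) (dgraph D (twist X f)))"
      using twist_insert[OF d(1), where X = X and f = f] insert.hyps(2) fo(2) d
      by (intro symcl_swap_merge finite_D bij_twist[OF assms(1)]) (auto simp: inv_in IH)
    also have "\<dots> = conn f (insert e X)"
      using symcl_Un_cong[OF IH[unfolded conn_def], of "{(d, \<alpha> d)}"]
      by (simp add: d conn_insert[OF d(1)])
    finally show ?case .
  qed
qed

text \<open>Each further edge contributes a transposition, which splits at most one cycle. This
  yields an Euler inequality for submaps.\<close>

lemma card_twist_le:
  assumes "Z \<subseteq> E" 
  shows "card (D // symcl (dgraph D (twist (X \<union> Z) f))) \<le> card (D // symcl (dgraph D (twist X f))) + card Z"
proof -
  have "finite Z" using assms finite_E finite_subset by blast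
  then show ?thesis using assms
  proof (induction Z)
    case (insert e Z)
    from insert.prems obtain d where d: "d \<in> D" "e = {d, \<alpha> d}" by (auto elim: edgeE)
    have "card (D // symcl (dgraph D (twist (insert e (X \<union> Z)) f))) 
      \<le> card (D // symcl (dgraph D (twist (X \<union> Z) f))) + 1"
    proof (cases "e \<in> X \<union> Z")
      case True
      then show ?thesis by (simp add: insert_absorb)
    next
      case False
      then show ?thesis using twist_insert[OF d(1), where X = "X \<union> Z" and f = f] d
        by (intro card_orbits_swap[of D d "\<alpha> d"] finite_D) (auto simp: inv_in)
    qed
    with insert show ?case by simp
  qed simp
qed

end

section \<open>Plane maps\<close>

locale plane_dart_system = dart_system +
  fixes \<sigma> :: "'a \<Rightarrow> 'a"
  assumes bij_\<sigma>: "bij_betw \<sigma> D D"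
    and euler: "card (D // conn \<sigma> {}) + card (D // conn (\<sigma> \<circ> \<alpha>) {}) = card E + 2"
begin

abbreviation \<phi> :: "'a \<Rightarrow> 'a" where "\<phi> \<equiv> \<sigma> \<circ> \<alpha>"

lemma bij_\<phi>: "bij_betw \<phi> D D"
  using bij_inv bij_\<sigma> by (rule bij_betw_trans)

lemma D_nonempty: "D \<noteq> {}"
  using euler by (auto simp: quotient_def)

text \<open>A spanning tree has a single face, and walking around it one only crosses edges
  outside the tree.\<close>

lemma dual_connected:
  assumes T: "forest \<sigma> T" "card (D // conn \<sigma> T) = 1" and "x \<in> D" "y \<in> D"
  shows "(x, y) \<in> conn \<phi> (E - T)"
proof -
  obtain C where "D // conn \<sigma> T = {C}" using T(2) by (auto simp: card_1_singleton_iff)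
  moreover have "conn \<sigma> T `` {x} \<in> D // conn \<sigma> T" "conn \<sigma> T `` {y} \<in> D // conn \<sigma> T"
    using assms by (auto simp: quotient_def)
  ultimately have "conn \<sigma> T `` {x} = conn \<sigma> T `` {y}" by auto
  then have "(x, y) \<in> symcl (dgraph D (twist T \<sigma>))"
    by (simp add: conn_Image_eq_iff forest_twist[OF bij_\<sigma> T(1)])
  also have "symcl (dgraph D (twist T \<sigma>)) \<subseteq> conn \<phi> (E - T)"
    unfolding conn_def
  proof (rule symcl_least, fold conn_def, clarsimp simp: dgraph_def)
    fix d assume d: "d \<in> D"
    \<comment> \<open>At a tree dart the twist is the face step \<open>\<phi> d\<close>. At any
      other dart it is \<open>\<sigma> d\<close>, which is \<open>\<phi> (\<alpha> d)\<close> and is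
      reached by crossing the dual edge first.\<close>
    show "(d, twist T \<sigma> d) \<in> conn \<phi> (E - T)"
    proof (cases "{d, \<alpha> d} \<in> T")
      case True
      then show ?thesis using conn_step[OF d, of \<phi>] by (simp add: twist_def)
    next
      case False
      then have "(d, \<alpha> d) \<in> conn \<phi> (E - T)" using d by (intro conn_link) (auto simp: edge_in_E)
      moreover have "(\<alpha> d, \<sigma> d) \<in> conn \<phi> (E - T)"
        using conn_step[OF inv_in[OF d], of \<phi>] d by (simp add: inv_inv)
      ultimately show ?thesis using False by (auto simp: twist_def intro: conn_trans)
    qed
  qed
  finally show ?thesis .
qed

text \<open>\<open>S\<close> encodes a simple graph on the dual components of \<open>F\<close>. If all degrees were at least 6, every
  face of the dual submap with edges \<open>F \<union> S\<close> would have at least three \<open>S\<close>-darts on its boundary,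
  contradicting Euler's formula.\<close>

lemma min_degree_le_5:
  assumes F: "forest \<phi> F" and S: "S \<subseteq> D" "\<And>d. d \<in> S \<Longrightarrow> \<alpha> d \<in> S"
    and loop: "\<And>d. d \<in> S \<Longrightarrow> (d, \<alpha> d) \<notin> conn \<phi> F"
    and par: "\<And>d d'. d \<in> S \<Longrightarrow> d' \<in> S \<Longrightarrow> (d, d') \<in> conn \<phi> F \<Longrightarrow> (\<alpha> d, \<alpha> d') \<in> conn \<phi> F \<Longrightarrow> d = d'"
  shows "\<exists>x\<in>D. card (S \<inter> conn \<phi> F `` {x}) \<le> 5"
proof (rule ccontr)
  let ?K = "conn \<phi> F" and ?Se = "(\<lambda>d. {d, \<alpha> d}) ` S"
  \<comment> \<open>The classes of \<open>?G\<close> are the faces of the dual submap, those of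
    \<open>?K\<close> the contracted vertices.\<close>
  let ?\<pi> = "twist (F \<union> ?Se) \<phi>"
  let ?G = "symcl (dgraph D ?\<pi>)"
  assume "\<not> ?thesis"
  then have deg: "card (S \<inter> ?K `` {x}) \<ge> 6" if "x \<in> D" for x using that by force
  have finS: "finite S" using S finite_D finite_subset by blast
  have FE: "F \<subseteq> E" using F by (simp add: forest_def)
  have in_Se: "{d, \<alpha> d} \<in> ?Se \<longleftrightarrow> d \<in> S" if "d \<in> D" for d
    using S edge_eq_iff that by fastforce
  \<comment> \<open>A face walk changes its contracted vertex only at darts of
    \<open>S\<close>.\<close>
  have \<pi>_S: "(\<alpha> d, ?\<pi> d) \<in> ?K" if "d \<in> S" for d
    using that S conn_step[of "\<alpha> d" \<phi>] by (auto simp: twist_def)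
  have \<pi>_nS: "(d, ?\<pi> d) \<in> ?K" if d: "d \<in> D" "d \<notin> S" for d
  proof (cases "{d, \<alpha> d} \<in> F")
    case True
    then have "(d, \<alpha> d) \<in> ?K" using d by (intro conn_link) auto
    moreover have "(\<alpha> d, \<phi> (\<alpha> d)) \<in> ?K" using d by (intro conn_step inv_in)
    ultimately have "(d, \<phi> (\<alpha> d)) \<in> ?K" by (rule conn_trans)
    with True show ?thesis by (simp add: twist_def)
  next
    case False
    with d in_Se show ?thesis using conn_step[of d \<phi>] by (auto simp: twist_def)
  qed
  have bij_\<pi>: "bij_betw ?\<pi> D D" by (rule bij_twist[OF bij_\<phi>])
  then have \<pi>D: "d \<in> D \<Longrightarrow> ?\<pi> d \<in> D" for d by (auto simp: bij_betw_def)
  have \<pi>G: "(d, ?\<pi> d) \<in> ?G" if "d \<in> D" for d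
    using that by (auto intro: symcl_base simp: dgraph_def)
  \<comment> \<open>Past \<open>d\<close> the walk is at the vertex of \<open>\<alpha> d\<close>,
    which differs from that of \<open>d\<close> as \<open>S\<close> has no loops. The walk is
    cyclic, so it must leave that vertex again, which needs another dart of
    \<open>S\<close>.\<close>
  have next_dart: "\<exists>d'\<in>S. (x, d') \<in> ?G \<and> (\<alpha> d, d') \<in> ?K" if d: "d \<in> S" "(x, d) \<in> ?G" for x d
  proof (rule ccontr)
    assume n: "\<not> ?thesis"
    have dD: "d \<in> D" using d S by auto
    have "orb ?\<pi> (?\<pi> d) \<subseteq> {z \<in> D. (x, z) \<in> ?G \<and> (\<alpha> d, z) \<in> ?K}"
    proof (rule orb_least)
      show "?\<pi> d \<in> {z \<in> D. (x, z) \<in> ?G \<and> (\<alpha> d, z) \<in> ?K}"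
        using \<pi>D[OF dD] \<pi>_S[OF d(1)] symcl_trans[OF d(2) \<pi>G[OF dD]] by simp
    next
      fix z assume z: "z \<in> {z \<in> D. (x, z) \<in> ?G \<and> (\<alpha> d, z) \<in> ?K}"
      with n have "z \<notin> S" by auto
      with z show "?\<pi> z \<in> {z \<in> D. (x, z) \<in> ?G \<and> (\<alpha> d, z) \<in> ?K}"
        using \<pi>D[of z] \<pi>_nS[of z] \<pi>G[of z] conn_trans[of "\<alpha> d" z \<phi> F "?\<pi> z"] symcl_trans[of x z _ "?\<pi> z"] by simp
    qed
    moreover have "d \<in> orb ?\<pi> (?\<pi> d)"
      using symcl_dgraph_Image[OF finite_D bij_\<pi> \<pi>D[OF dD]] symcl_sym[OF \<pi>G[OF dD]] by auto
    ultimately have "(\<alpha> d, d) \<in> ?K" by auto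
    with loop[OF d(1)] show False by (auto dest: conn_sym)
  qed
  \<comment> \<open>If \<open>B\<close> covers the \<open>S\<close>-darts on the face of
    \<open>x\<close>, the walks of the two submaps agree there. The forest
    \<open>F \<union> B\<close> has one face per component, so this face contains the whole
    component.\<close>
  have inside: "conn \<phi> (F \<union> B) `` {x} \<subseteq> ?G `` {x}"
    if B: "forest \<phi> (F \<union> B)" "B \<subseteq> ?Se" "S \<inter> ?G `` {x} \<subseteq> darts B" "x \<in> D" for B x
  proof -
    have "conn \<phi> (F \<union> B) `` {x} = orb (twist (F \<union> B) \<phi>) x"
      using forest_twist[OF bij_\<phi> B(1)] symcl_dgraph_Image[OF finite_D bij_twist[OF bij_\<phi>] B(4)] by auto
    also have "\<dots> \<subseteq> D \<inter> ?G `` {x}"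
    proof (rule orb_least)
      fix z assume z: "z \<in> D \<inter> ?G `` {x}"
      have "{z, \<alpha> z} \<in> F \<union> B \<longleftrightarrow> {z, \<alpha> z} \<in> F \<union> ?Se"
        using z B(2,3) in_Se[of z] by (auto simp: darts_def)
      then have "twist (F \<union> B) \<phi> z = ?\<pi> z" by (simp add: twist_def)
      then show "twist (F \<union> B) \<phi> z \<in> D \<inter> ?G `` {x}"
        using z \<pi>D[of z] \<pi>G[of z] by (auto dest: symcl_trans)
    qed (use B(4) in simp)
    finally show ?thesis by auto
  qed
  have big: "card (S \<inter> ?G `` {x}) \<ge> 3" if x: "x \<in> D" for x
  proof (rule ccontr)
    assume small: "\<not> card (S \<inter> ?G `` {x}) \<ge> 3"
    have fin: "finite (S \<inter> ?G `` {x})" using finS by simp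
    show False
    proof (cases "S \<inter> ?G `` {x} = {}")
      case True
      \<comment> \<open>A face without \<open>S\<close>-darts contains the whole contracted vertex,
        which then has degree 0.\<close>
      then have "?K `` {x} \<subseteq> ?G `` {x}" using inside[of "{}" x] F x by auto
      with True have "S \<inter> ?K `` {x} = {}" by auto
      with deg[OF x] show False by simp
    next
      case False
      \<comment> \<open>With at most two \<open>S\<close>-darts on the face, the third one found is
        the first again. Then \<open>\<alpha> d1\<close> and \<open>d2\<close> are parallel, hence
        equal, and the face surrounds a lone edge whose end has degree at most 2.\<close>
      then obtain d1 where d1: "d1 \<in> S" "(x, d1) \<in> ?G" by auto
      then obtain d2 where d2: "d2 \<in> S" "(x, d2) \<in> ?G" "(\<alpha> d1, d2) \<in> ?K" using next_dart by blast
      then obtain d3 where d3: "d3 \<in> S" "(x, d3) \<in> ?G" "(\<alpha> d2, d3) \<in> ?K" using next_dart by blast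
      have n12: "d1 \<noteq> d2" using loop[OF d1(1)] d2(3) by (auto dest: conn_sym)
      have n23: "d2 \<noteq> d3" using loop[OF d2(1)] d3(3) by (auto dest: conn_sym)
      have only: "S \<inter> ?G `` {x} = {d1, d2}"
      proof (rule card_seteq[symmetric, OF fin])
        show "{d1, d2} \<subseteq> S \<inter> ?G `` {x}" using d1 d2 by auto
        show "card (S \<inter> ?G `` {x}) \<le> card {d1, d2}" using small n12 by simp
      qed
      with d3 n23 have "d3 = d1" by auto
      have d1D: "d1 \<in> D" using d1 S by auto
      have "\<alpha> d1 = d2"
        using par[of "\<alpha> d1" d2] d1 d2 d3 S \<open>d3 = d1\<close> inv_inv[OF d1D] by (auto dest: conn_sym)
      let ?B = "{{d1, \<alpha> d1}}"
      have "conn \<phi> (F \<union> ?B) `` {d1} \<subseteq> ?G `` {d1}"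
      proof (rule inside)
        show "forest \<phi> (F \<union> ?B)" using forest_insertI[OF F d1D loop[OF d1(1)]] by simp
        show "?B \<subseteq> ?Se" using d1 by auto
        have "?G `` {d1} = ?G `` {x}" using symcl_sym[OF d1(2)] by (simp add: symcl_Image_eq_iff)
        then show "S \<inter> ?G `` {d1} \<subseteq> darts ?B"
          using only \<open>\<alpha> d1 = d2\<close> d1D inv_in[OF d1D] edge_inv[OF d1D] by (auto simp: darts_def)
      qed (rule d1D)
      moreover have "?K \<subseteq> conn \<phi> (F \<union> ?B)" by (rule conn_mono) auto
      moreover have "?G `` {d1} = ?G `` {x}" using symcl_sym[OF d1(2)] by (simp add: symcl_Image_eq_iff)
      ultimately have "S \<inter> ?K `` {d1} \<subseteq> {d1, d2}" using only by blast
      then have "card (S \<inter> ?K `` {d1}) \<le> card {d1, d2}" by (intro card_mono) auto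
      with deg[OF d1D] n12 show False by simp
    qed
  qed
  \<comment> \<open>Double counting with \<open>f\<close> faces and \<open>v\<close> contracted
    vertices: \<open>3 * f\<close> and \<open>6 * v\<close> are at most \<open>card S\<close>,
    itself at most \<open>2 * card ?Se\<close>, so \<open>v + f \<le> card ?Se\<close>. Euler's
    formula demands at least \<open>card ?Se + 2\<close>.\<close>
  have "3 * card (D // ?G) = (\<Sum>C\<in>D // ?G. 3)" by simp
  also have "\<dots> \<le> (\<Sum>C\<in>D // ?G. card (S \<inter> C))"
    by (rule sum_mono) (use big in \<open>auto simp: quotient_def\<close>)
  finally have faces: "3 * card (D // ?G) \<le> card S"
    using sum_card_classes[OF finite_D S(1)] by simp
  have "6 * card (D // ?K) = (\<Sum>C\<in>D // ?K. 6)" by simp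
  also have "\<dots> \<le> (\<Sum>C\<in>D // ?K. card (S \<inter> C))"
    by (rule sum_mono) (use deg in \<open>auto simp: quotient_def\<close>)
  finally have verts: "6 * card (D // ?K) \<le> card S"
    using sum_card_classes[OF finite_D S(1)] by (simp add: conn_def)
  have "card S \<le> card (\<Union> ?Se)"
    using finS S(2) by (intro card_mono) auto
  also have "\<dots> \<le> (\<Sum>e\<in>?Se. card e)" using card_Union_le_sum_card[of ?Se] by simp
  also have "\<dots> \<le> (\<Sum>e\<in>?Se. 2)" by (rule sum_mono) (auto simp: card_insert_if)
  finally have edges: "card S \<le> 2 * card ?Se" by simp
  have SeE: "?Se \<subseteq> E" using S edge_in_E by auto
  have "F \<inter> ?Se = {}"
    using S loop conn_link by blast
  then have cardY: "card (F \<union> ?Se) = card F + card ?Se"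
    using finite_subset[OF FE finite_E] finS by (intro card_Un_disjoint) auto
  \<comment> \<open>With all edges present, the face permutation of the dual is
    \<open>\<sigma>\<close>: faces of the dual are primal vertices, so adding the remaining edges
    compares \<open>?G\<close> with these.\<close>
  have "twist E \<phi> d = \<sigma> d" if "d \<in> D" for d
    using that edge_in_E by (simp add: twist_def inv_inv)
  then have "symcl (dgraph D (twist E \<phi>)) = conn \<sigma> {}"
    using dgraph_cong[of D "twist E \<phi>" \<sigma>] by (simp add: conn_empty)
  moreover have "(F \<union> ?Se) \<union> (E - (F \<union> ?Se)) = E" using FE SeE by auto
  ultimately have "card (D // conn \<sigma> {}) \<le> card (D // ?G) + card (E - (F \<union> ?Se))"
    using card_twist_le[of "E - (F \<union> ?Se)" "F \<union> ?Se" \<phi>] by simp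
  also have "card (E - (F \<union> ?Se)) = card E - card (F \<union> ?Se)"
    using finite_subset[OF FE finite_E] finS FE SeE by (intro card_Diff_subset) auto
  finally have "card (D // conn \<sigma> {}) + card F + card ?Se \<le> card (D // ?G) + card E"
    using cardY card_mono[OF finite_E Un_least[OF FE SeE]] by linarith
  with euler F faces verts edges show False
    unfolding forest_def by linarith
qed

end

section \<open>Expected number of queries\<close>

lemma measurable_shift: "(\<lambda>\<omega>. \<omega> \<circ> Suc) \<in> measurable (noise p) (noise p)"
  unfolding noise_def comp_def
  by (rule measurable_PiM_single') (auto simp: space_PiM)

lemma measurable_first: "(\<lambda>\<omega>. \<omega> 0) \<in> measurable (noise p) (count_space UNIV)"
proof -
  have "(\<lambda>\<omega>. \<omega> 0) \<in> measurable (noise p) (measure_pmf (bernoulli_pmf p))"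
    unfolding noise_def by (rule measurable_component_singleton) simp
  then show ?thesis by simp
qed

text \<open>The noise is a Bernoulli bit followed by an independent copy of itself; the integral is
  split by the first bit.\<close>

lemma nn_integral_noise:
  assumes "f \<in> borel_measurable (noise p)" "0 \<le> p" "p \<le> 1"
  shows "(\<integral>\<^sup>+\<omega>. f \<omega> \<partial>noise p) =
    ennreal p * (\<integral>\<^sup>+\<omega>. f (case_nat True \<omega>) \<partial>noise p) + ennreal (1 - p) * (\<integral>\<^sup>+\<omega>. f (case_nat False \<omega>) \<partial>noise p)"
proof -
  let ?B = "measure_pmf (bernoulli_pmf p)"
  interpret sequence_space ?B
    by unfold_locales
  have S: "noise p = S" by (simp add: noise_def)
  have m: "(\<lambda>(b, \<omega>). case_nat b \<omega>) \<in> measurable (?B \<Otimes>\<^sub>M S) S"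
    by measurable
  have "(\<integral>\<^sup>+\<omega>. f \<omega> \<partial>S) = (\<integral>\<^sup>+\<omega>. f \<omega> \<partial>distr (?B \<Otimes>\<^sub>M S) S (\<lambda>(b, \<omega>). case_nat b \<omega>))"
    by (simp add: PiM_iter)
  also have "\<dots> = (\<integral>\<^sup>+x. f (case x of (b, \<omega>) \<Rightarrow> case_nat b \<omega>) \<partial>(?B \<Otimes>\<^sub>M S))"
    using assms(1) S by (intro nn_integral_distr m) simp
  also have "\<dots> = (\<integral>\<^sup>+b. \<integral>\<^sup>+\<omega>. f (case_nat b \<omega>) \<partial>S \<partial>?B)"
    using measurable_compose[OF m, of f] assms(1) S
    by (subst P.nn_integral_fst[symmetric]) auto
  also have "\<dots> = (\<integral>\<^sup>+\<omega>. f (case_nat True \<omega>) \<partial>S) * p + (\<integral>\<^sup>+\<omega>. f (case_nat False \<omega>) \<partial>S) * (1 - p)"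
    using assms by (simp add: nn_integral_bernoulli_pmf)
  finally show ?thesis by (simp add: S mult.commute)
qed

lemma prob_space_noise: "prob_space (noise p)"
  unfolding noise_def by (intro prob_space_PiM measure_pmf.prob_space_axioms)

text \<open>Unrolling one query at a time, rather than one DISCOVER call, makes the noise after each
  step a fresh copy of the whole noise sequence. The run is truncated after \<open>N\<close> queries.\<close>

primrec cost :: "('e set \<Rightarrow> bool) \<Rightarrow> 'e set \<Rightarrow> ('e set \<Rightarrow> 'e list list) \<Rightarrow> nat \<Rightarrow> 'e set \<Rightarrow> nat
    \<Rightarrow> (nat \<Rightarrow> bool) \<Rightarrow> nat" where
  "cost final T ch 0 F q \<omega> = 0"
| "cost final T ch (Suc N) F q \<omega> = (if final F then 0 else
     1 + (if qedge (ch F) q \<notin> T \<and> \<not> \<omega> 0 then cost final T ch N (F \<union> {qedge (ch F) q}) 0 (\<omega> \<circ> Suc)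
          else cost final T ch N F (Suc q) (\<omega> \<circ> Suc)))"

text \<open>The expectation of \<open>cost\<close> as a plain recursion, so that bounds on it need
  no integrals. The weight \<open>p\<close> is that of a false positive, after which DISCOVER goes
  on.\<close>

primrec expcost :: "real \<Rightarrow> ('e set \<Rightarrow> bool) \<Rightarrow> 'e set \<Rightarrow> ('e set \<Rightarrow> 'e list list) \<Rightarrow> nat \<Rightarrow> 'e set \<Rightarrow> nat
    \<Rightarrow> real" where
  "expcost p final T ch 0 F q = 0"
| "expcost p final T ch (Suc N) F q = (if final F then 0 else
     1 + (if qedge (ch F) q \<notin> T
          then p * expcost p final T ch N F (Suc q) + (1 - p) * expcost p final T ch N (F \<union> {qedge (ch F) q}) 0
          else expcost p final T ch N F (Suc q)))"

lemma expcost_nonneg: "0 \<le> p \<Longrightarrow> p \<le> 1 \<Longrightarrow> 0 \<le> expcost p final T ch N F q"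
  by (induction N arbitrary: F q) auto

lemma measurable_cost: "cost final T ch N F q \<in> measurable (noise p) (count_space UNIV)"
proof (induction N arbitrary: F q)
  case (Suc N)
  have sh: "(\<lambda>\<omega>. cost final T ch N F q (\<omega> \<circ> Suc)) \<in> measurable (noise p) (count_space UNIV)" for F q
    by (rule measurable_compose[OF measurable_shift Suc])
  note [measurable] = sh measurable_first
  show ?case by simp
next
  case 0
  have "cost final T ch 0 F q = (\<lambda>_. 0)" by (simp add: fun_eq_iff)
  then show ?case by simp
qed

lemma nn_integral_cost:
  assumes "0 \<le> p" "p \<le> 1"
  shows "(\<integral>\<^sup>+\<omega>. ennreal (real (cost final T ch N F q \<omega>)) \<partial>noise p) = ennreal (expcost p final T ch N F q)"
proof (induction N arbitrary: F q)
  case (Suc N)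
  interpret prob_space "noise p" by (rule prob_space_noise)
  have [measurable]: "cost final T ch N F q \<in> measurable (noise p) (count_space UNIV)" for N F q
    by (rule measurable_cost)
  have suc: "(\<integral>\<^sup>+\<omega>. ennreal (real (1 + cost final T ch N F q \<omega>)) \<partial>noise p) 
      = ennreal (1 + expcost p final T ch N F q)" for F q
  proof -
    have "(\<integral>\<^sup>+\<omega>. ennreal (real (1 + cost final T ch N F q \<omega>)) \<partial>noise p)
      = (\<integral>\<^sup>+\<omega>. 1 + ennreal (real (cost final T ch N F q \<omega>)) \<partial>noise p)"
      by (intro nn_integral_cong) (simp add: ennreal_plus)
    also have "\<dots> = 1 + ennreal (expcost p final T ch N F q)"
      by (subst nn_integral_add) (auto simp: Suc emeasure_space_1)
    finally show ?thesis using expcost_nonneg[OF assms, of final T ch N F q] by (simp add: ennreal_plus)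
  qed
  have sh: "(case_nat b \<omega>) \<circ> Suc = \<omega>" for b and \<omega> :: "nat \<Rightarrow> bool" by (auto simp: fun_eq_iff)
  have nn: "0 \<le> expcost p final T ch N F q" for F q by (rule expcost_nonneg[OF assms])
  have "(\<integral>\<^sup>+\<omega>. ennreal (real (cost final T ch (Suc N) F q \<omega>)) \<partial>noise p) =
     ennreal p * (\<integral>\<^sup>+\<omega>. ennreal (real (cost final T ch (Suc N) F q (case_nat True \<omega>))) \<partial>noise p) +
     ennreal (1 - p) * (\<integral>\<^sup>+\<omega>. ennreal (real (cost final T ch (Suc N) F q (case_nat False \<omega>))) \<partial>noise p)"
    by (rule nn_integral_noise[OF _ assms]) measurable
  also have "\<dots> = ennreal (expcost p final T ch (Suc N) F q)"
  proof (cases "final F")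
    case False
    show ?thesis
    proof (cases "qedge (ch F) q \<in> T")
      case True
      then have "ennreal p * (\<integral>\<^sup>+\<omega>. ennreal (real (cost final T ch (Suc N) F q (case_nat True \<omega>))) \<partial>noise p) +
         ennreal (1 - p) * (\<integral>\<^sup>+\<omega>. ennreal (real (cost final T ch (Suc N) F q (case_nat False \<omega>))) \<partial>noise p)
         = ennreal p * ennreal (1 + expcost p final T ch N F (Suc q)) +
           ennreal (1 - p) * ennreal (1 + expcost p final T ch N F (Suc q))"
        using False by (simp only: cost.simps sh suc simp_thms if_False)
      also have "\<dots> = ennreal (p * (1 + expcost p final T ch N F (Suc q)) + (1 - p) * (1 + expcost p final T ch N F (Suc q)))"
        using assms nn by (simp add: ennreal_plus ennreal_mult)
      also have "p * (1 + expcost p final T ch N F (Suc q)) + (1 - p) * (1 + expcost p final T ch N F (Suc q)) 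
         = expcost p final T ch (Suc N) F q"
        using True False by (simp add: algebra_simps)
      finally show ?thesis .
    next
      case nT: False
      let ?F = "F \<union> {qedge (ch F) q}"
      have "ennreal p * (\<integral>\<^sup>+\<omega>. ennreal (real (cost final T ch (Suc N) F q (case_nat True \<omega>))) \<partial>noise p) +
         ennreal (1 - p) * (\<integral>\<^sup>+\<omega>. ennreal (real (cost final T ch (Suc N) F q (case_nat False \<omega>))) \<partial>noise p)
         = ennreal p * ennreal (1 + expcost p final T ch N F (Suc q)) +
           ennreal (1 - p) * ennreal (1 + expcost p final T ch N ?F 0)"
        using False nT by (simp only: cost.simps sh suc simp_thms if_False if_True nat.case)
      also have "\<dots> = ennreal (p * (1 + expcost p final T ch N F (Suc q)) + (1 - p) * (1 + expcost p final T ch N ?F 0))"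
        using assms nn by (simp add: ennreal_plus ennreal_mult)
      also have "p * (1 + expcost p final T ch N F (Suc q)) + (1 - p) * (1 + expcost p final T ch N ?F 0)
         = expcost p final T ch (Suc N) F q"
        using nT False by (simp add: algebra_simps)
      finally show ?thesis .
    qed
  qed simp
  finally show ?case .
qed simp

text \<open>Some fixed edge outside \<open>T\<close> is queried once in each period of \<open>P\<close> queries, so DISCOVER makes at
  most \<open>P / (1 - p)\<close> queries in expectation, which the drop of the potential \<open>r\<close> by \<open>s\<close> pays for.\<close>

definition good_period :: "('e set \<Rightarrow> bool) \<Rightarrow> 'e set \<Rightarrow> ('e set \<Rightarrow> 'e list list) \<Rightarrow> ('e set \<Rightarrow> nat)
   \<Rightarrow> 'e set \<Rightarrow> nat \<Rightarrow> nat \<Rightarrow> nat \<Rightarrow> bool" where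
  "good_period good T ch r F s P q\<^sub>0 \<longleftrightarrow> q\<^sub>0 < P \<and> P \<le> 5 * s \<and>
     (\<forall>q. q mod P = q\<^sub>0 \<longrightarrow> qedge (ch F) q \<notin> T) \<and>
     (\<forall>q. qedge (ch F) q \<notin> T \<longrightarrow> good (F \<union> {qedge (ch F) q}) \<and> r (F \<union> {qedge (ch F) q}) + s \<le> r F)"

lemma expcost_le:
  fixes p :: real
  assumes p: "0 \<le> p" "p < 1"
    and progress: "\<And>F. good F \<Longrightarrow> \<not> final F \<Longrightarrow> \<exists>s P q\<^sub>0. good_period good T ch r F s P q\<^sub>0"
    and "good F"
  shows "expcost p final T ch N F 0 \<le> 5 / (1 - p) * real (r F)"
proof -
  define K where "K = 5 / (1 - p)"
  have K0: "K \<ge> 0" using p by (simp add: K_def)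
  let ?e = "expcost p final T ch"
  \<comment> \<open>The bound at the start of a DISCOVER call follows from the one inside it, which
    is a premise here because its own induction needs \<open>start\<close> at smaller
    \<open>N\<close>. The last terms stand for \<open>j + 1\<close> queries through the next query
    of the fixed edge and, with probability \<open>p\<close>, a further
    \<open>P / (1 - p)\<close>.\<close>
  have start: "?e N F 0 \<le> K * real (r F)" 
    if bound: "\<And>F s P q\<^sub>0 q j. good F \<Longrightarrow> \<not> final F \<Longrightarrow> good_period good T ch r F s P q\<^sub>0 \<Longrightarrow> 
       (q + j) mod P = q\<^sub>0 \<Longrightarrow> j < P \<Longrightarrow> ?e N F q \<le> K * (real (r F) - real s) + (real j + 1) + p / (1 - p) * P" 
    and F: "good F" for N F
  proof (cases "final F")
    case True
    then have "?e N F 0 = 0" by (cases N) auto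
    then show ?thesis using K0 by simp
  next
    case False
    then obtain s P q\<^sub>0 where w: "good_period good T ch r F s P q\<^sub>0" using progress F by blast
    then have P: "q\<^sub>0 < P" "P \<le> 5 * s" by (auto simp: good_period_def)
    have "?e N F 0 \<le> K * (real (r F) - real s) + (real q\<^sub>0 + 1) + p / (1 - p) * P"
      using bound[OF F False w, of 0 q\<^sub>0] P by simp
    \<comment> \<open>\<open>q\<^sub>0 + 1 \<le> P\<close>, and
      \<open>P + p / (1 - p) * P = P / (1 - p)\<close> is at most \<open>K * s\<close>, the amount
      released by the potential.\<close>
    also have "\<dots> \<le> K * (real (r F) - real s) + (real P + p / (1 - p) * P)"
      using P by simp
    also have "real P + p / (1 - p) * P = P / (1 - p)"
      using p by (simp add: field_simps)
    also have "\<dots> \<le> (5 * real s) / (1 - p)"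
      using P p by (intro divide_right_mono) auto
    also have "K * (real (r F) - real s) + (5 * real s) / (1 - p) = K * real (r F)"
      by (simp add: K_def diff_divide_distrib right_diff_distrib mult.commute)
    finally show ?thesis by simp
  qed
  \<comment> \<open>\<open>j\<close> queries are made before the next query of the fixed edge.\<close>
  have bound: "?e N F q \<le> K * (real (r F) - real s) + (real j + 1) + p / (1 - p) * P"
    if "good F" "\<not> final F" "good_period good T ch r F s P q\<^sub>0" "(q + j) mod P = q\<^sub>0" "j < P"
    for N F s P q\<^sub>0 q j
    using that
  proof (induction N arbitrary: F s P q\<^sub>0 q j)
    case 0
    \<comment> \<open>Returning the edge at offset \<open>j\<close> lowers the potential by at least
      \<open>s\<close>; hence \<open>s \<le> r F\<close> and the bound is nonnegative.\<close>
    then have "qedge (ch F) (q + j) \<notin> T" by (auto simp: good_period_def)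
    with 0 have "s \<le> r F" by (fastforce simp: good_period_def)
    with K0 p show ?case by (simp add: add_nonneg_nonneg)
  next
    case (Suc N)
    let ?F = "F \<union> {qedge (ch F) q}"
    have "qedge (ch F) (q + j) \<notin> T" using Suc.prems by (auto simp: good_period_def)
    with Suc.prems have sr: "s \<le> r F" by (fastforce simp: good_period_def)
    define R where "R = real (r F) - real s"
    have R0: "K * R \<ge> 0" using sr K0 by (simp add: R_def)
    have new: "?e N ?F 0 \<le> K * R" if "qedge (ch F) q \<notin> T"
    proof -
      have "good ?F" "r ?F + s \<le> r F" using that Suc.prems by (auto simp: good_period_def)
      then have "?e N ?F 0 \<le> K * real (r ?F)" by (intro start Suc.IH)
      also have "\<dots> \<le> K * R" using \<open>r ?F + s \<le> r F\<close> K0 by (intro mult_left_mono) (auto simp: R_def)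
      finally show ?thesis .
    qed
    show ?case
    proof (cases j)
      case 0
      then have nT: "qedge (ch F) q \<notin> T" using Suc.prems by (auto simp: good_period_def)
      \<comment> \<open>The fixed edge is queried now; after a false positive, \<open>P - 1\<close>
        queries precede its next turn.\<close>
      have "(Suc q + (P - 1)) mod P = q\<^sub>0" "P - 1 < P" "real (P - 1) + 1 = P" using Suc.prems 0 by auto
      then have "?e N F (Suc q) \<le> K * R + P + p / (1 - p) * P"
        using Suc.IH[OF Suc.prems(1-3), of "Suc q" "P - 1"] by (simp add: R_def)
      then have "p * ?e N F (Suc q) \<le> p * (K * R + P + p / (1 - p) * P)"
        using p by (intro mult_left_mono)
      moreover have "(1 - p) * ?e N ?F 0 \<le> (1 - p) * (K * R)"
        using p new[OF nT] by (intro mult_left_mono) auto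
      moreover have "p * (K * R + P + p / (1 - p) * P) + (1 - p) * (K * R) = K * R + p / (1 - p) * P"
        using p by (simp add: field_simps)
      ultimately show ?thesis using nT Suc.prems(2) 0 by (simp add: R_def)
    next
      case j: (Suc i)
      have IH: "?e N F (Suc q) \<le> K * R + (real i + 1) + p / (1 - p) * P"
        using Suc.IH[OF Suc.prems(1-3), of "Suc q" i] Suc.prems j by (simp add: R_def)
      show ?thesis
      proof (cases "qedge (ch F) q \<in> T")
        case True
        then show ?thesis using IH j Suc.prems(2) by (simp add: R_def)
      next
        case False
        \<comment> \<open>A success at another edge only does better, so both outcomes lie below the
          target.\<close>
        have "K * R \<le> K * R + (real i + 1) + p / (1 - p) * P" using p by simp
        then have "?e N ?F 0 \<le> K * R + (real i + 1) + p / (1 - p) * P" using new[OF False] by linarith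
        then have "p * ?e N F (Suc q) + (1 - p) * ?e N ?F 0 \<le> K * R + (real i + 1) + p / (1 - p) * P"
          using IH p by (intro convex_bound_le) auto
        then show ?thesis using False j Suc.prems(2) by (simp add: R_def)
      qed
    qed
  qed
  show ?thesis using start[OF bound \<open>good F\<close>] by (simp add: K_def)
qed

section \<open>Dual components and super-edges\<close>

text \<open>For comparing two encodings of dual vertices, as sets of faces and as classes of darts:
  only which darts are identified matters.\<close>

lemma card_image_le_of_kernel:
  assumes "finite A" "\<And>x y. x \<in> A \<Longrightarrow> y \<in> A \<Longrightarrow> g x = g y \<Longrightarrow> f x = f y"
  shows "card (f ` A) \<le> card (g ` A)"
proof -
  have "f ` A = (\<lambda>c. f (inv_into A g c)) ` g ` A"
    unfolding image_image
    by (intro image_cong refl assms(2)) (auto simp: inv_into_into f_inv_into_f)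
  then show ?thesis using assms(1) by (metis card_image_le finite_imageI)
qed

lemma card_image_eq_of_kernel:
  assumes "finite A" "\<And>x y. x \<in> A \<Longrightarrow> y \<in> A \<Longrightarrow> f x = f y \<longleftrightarrow> g x = g y"
  shows "card (f ` A) = card (g ` A)"
  using card_image_le_of_kernel[OF assms(1), of f g] card_image_le_of_kernel[OF assms(1), of g f] assms(2)
  by (intro antisym) auto

context dart_system
begin

text \<open>Paths of vertices or faces become chains of darts. Steps along edges are reversible
  because an edge has both of its darts.\<close>

lemma orbit_path_iff:
  assumes f: "bij_betw f D D" and "x \<in> D" "y \<in> D"
  shows "(orb f x, orb f y) \<in> {(orb f d, orb f (\<alpha> d)) | d. d \<in> D \<and> {d, \<alpha> d} \<in> X}\<^sup>* \<longleftrightarrow> (x, y) \<in> conn f X"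
    (is "_ \<in> ?Q\<^sup>* \<longleftrightarrow> _")
proof
  have same: "(a, b) \<in> conn f X" if "a \<in> D" "b \<in> D" "orb f a = orb f b" for a b
  proof -
    have "(a, b) \<in> conn f {}" using that orb_eq_iff[OF finite_D f] by (simp add: conn_empty)
    then show ?thesis using conn_mono[of "{}" X f] by auto
  qed
  assume "(orb f x, orb f y) \<in> ?Q\<^sup>*"
  then have "\<exists>z\<in>D. orb f y = orb f z \<and> (x, z) \<in> conn f X"
  proof (induction rule: rtrancl_induct)
    case base
    then show ?case using assms(2) by auto
  next
    case (step A B)
    then obtain z d where z: "z \<in> D" "A = orb f z" "(x, z) \<in> conn f X"
      and d: "d \<in> D" "{d, \<alpha> d} \<in> X" "A = orb f d" "B = orb f (\<alpha> d)" by auto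
    have "(x, d) \<in> conn f X" using z d same[of z d] by (auto intro: conn_trans)
    then have "(x, \<alpha> d) \<in> conn f X" using conn_link[OF d(1,2)] by (rule conn_trans)
    then show ?case using d inv_in by auto
  qed
  then show "(x, y) \<in> conn f X" using same assms(3) by (metis conn_trans)
next
  have same: "orb f (f a) = orb f a" if "a \<in> D" for a
  proof -
    have "f a \<in> D" using f that by (auto simp: bij_betw_def)
    with orb_eq_iff[OF finite_D f that this] conn_step[OF that, of f "{}"] show ?thesis
      by (simp add: conn_empty)
  qed
  assume "(x, y) \<in> conn f X"
  then have "y \<in> D \<and> (orb f x, orb f y) \<in> ?Q\<^sup>*"
    unfolding conn_def
  proof (induction rule: symcl_induct)
    case refl
    then show ?case using assms by auto
  next
    case (step y z)
    have fD: "f a \<in> D" if "a \<in> D" for a using f that by (auto simp: bij_betw_def)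
    from step.hyps(2) consider "z = f y" "y \<in> D" | "y = f z" "z \<in> D" | "y \<in> darts X" "z = \<alpha> y" | "z \<in> darts X" "y = \<alpha> z"
      by (auto simp: dgraph_def)
    then show ?case
    proof cases
      case 1 then show ?thesis using step.IH same fD by auto
    next
      case 2 then show ?thesis using step.IH same fD by auto
    next
      case 3 
      then have "(orb f y, orb f z) \<in> ?Q" by (auto simp: darts_def)
      then show ?thesis using 3 step.IH by (auto simp: darts_def inv_in intro: rtrancl_into_rtrancl)
    next
      case 4
      then have z: "z \<in> D" "{z, \<alpha> z} \<in> X" by (auto simp: darts_def)
      then have "(orb f y, orb f z) \<in> ?Q"
        using 4 edge_inv[OF z(1)] inv_inv[OF z(1)] inv_in[OF z(1)] by (intro CollectI exI[of _ y]) auto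
      then show ?thesis using z step.IH by (auto intro: rtrancl_into_rtrancl)
    qed
  qed
  then show "(orb f x, orb f y) \<in> ?Q\<^sup>*" by simp
qed

end

context plane_dart_system
begin

text \<open>The contracted dual vertex at which the dual dart \<open>d\<close> starts.\<close>

definition comp :: "'a set set \<Rightarrow> 'a \<Rightarrow> 'a set set" where
  "comp F d = dual_comp D \<alpha> \<sigma> F (orb \<phi> d)"

lemma comp_eq_iff:
  assumes "x \<in> D" "y \<in> D"
  shows "comp F x = comp F y \<longleftrightarrow> (x, y) \<in> conn \<phi> F"
proof -
  have mem: "orb \<phi> b \<in> comp F a \<longleftrightarrow> (a, b) \<in> conn \<phi> F" if "a \<in> D" "b \<in> D" for a b
    using orbit_path_iff[OF bij_\<phi> that, of F] that by (auto simp: comp_def dual_comp_def map_faces_def)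
  have sub: "\<And>a C. C \<in> comp F a \<Longrightarrow> \<exists>b\<in>D. C = orb \<phi> b"
    by (auto simp: comp_def dual_comp_def map_faces_def)
  show ?thesis
  proof
    assume "comp F x = comp F y"
    then show "(x, y) \<in> conn \<phi> F" using mem[of x y] mem[of y y] assms by auto
  next
    assume xy: "(x, y) \<in> conn \<phi> F"
    then have "(x, b) \<in> conn \<phi> F \<longleftrightarrow> (y, b) \<in> conn \<phi> F" for b
      by (meson conn_sym conn_trans)
    then show "comp F x = comp F y" using mem sub assms by (metis subsetI subset_antisym)
  qed
qed

lemma dual_comps_eq: "dual_comps D \<alpha> \<sigma> F = comp F ` D"
  by (auto simp: dual_comps_def comp_def map_faces_def)

lemma card_dual_comps: "card (dual_comps D \<alpha> \<sigma> F) = card (D // conn \<phi> F)"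
  unfolding dual_comps_eq quotient_def UNION_singleton_eq_range
  by (rule card_image_eq_of_kernel[OF finite_D]) (simp add: comp_eq_iff conn_Image_eq_iff)

lemma cends_edge: "cends D \<alpha> \<sigma> F {d, \<alpha> d} = {comp F d, comp F (\<alpha> d)}"
  by (simp add: cends_def dual_ends_def comp_def)

lemma edge_in_rem_edges_iff:
  "d \<in> D \<Longrightarrow> {d, \<alpha> d} \<in> rem_edges D \<alpha> \<sigma> F \<longleftrightarrow> comp F d \<noteq> comp F (\<alpha> d)"
  by (simp add: rem_edges_def cends_edge edge_in_E card_insert_if)

lemma rem_edges_subset: "rem_edges D \<alpha> \<sigma> F \<subseteq> E"
  by (auto simp: rem_edges_def)

lemma super_edgeE:
  assumes "e \<in> super_edge D \<alpha> \<sigma> F u w"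
  obtains d where "d \<in> D" "e = {d, \<alpha> d}" "comp F d = u" "comp F (\<alpha> d) = w" 
proof -
  from assms have e: "e \<in> E" and ce: "cends D \<alpha> \<sigma> F e = {u, w}"
    by (auto simp: super_edge_def rem_edges_def)
  from e obtain d where d: "d \<in> D" "e = {d, \<alpha> d}" by (rule edgeE)
  with ce consider "comp F d = u" "comp F (\<alpha> d) = w" | "comp F d = w" "comp F (\<alpha> d) = u"
    by (auto simp: cends_edge doubleton_eq_iff)
  then show thesis
  proof cases
    case 1 then show ?thesis using d that by auto
  next
    case 2 
    have "e = {\<alpha> d, \<alpha> (\<alpha> d)}" using d edge_inv by auto
    with 2 d that[of "\<alpha> d"] show ?thesis by (simp add: inv_in inv_inv)
  qed
qed

lemma in_super_edgeI:
  "d \<in> D \<Longrightarrow> comp F d \<noteq> comp F (\<alpha> d) \<Longrightarrow> {d, \<alpha> d} \<in> super_edge D \<alpha> \<sigma> F (comp F d) (comp F (\<alpha> d))"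
  by (simp add: super_edge_def edge_in_rem_edges_iff cends_edge)

lemma exists_cdeg_le_5:
  assumes F: "forest \<phi> F"
  shows "\<exists>u\<in>dual_comps D \<alpha> \<sigma> F. cdeg D \<alpha> \<sigma> F u \<le> 5"
proof -
  let ?c = "comp F"
  \<comment> \<open>One representative per unordered pair of adjacent vertices makes the graph
    simple; \<open>S\<close> holds both darts of each representative.\<close>
  define rep where "rep P = (SOME e. e \<in> E \<and> cends D \<alpha> \<sigma> F e = P)" for P
  define S where "S = {d \<in> D. ?c d \<noteq> ?c (\<alpha> d) \<and> rep {?c d, ?c (\<alpha> d)} = {d, \<alpha> d}}"
  have "\<exists>x\<in>D. card (S \<inter> conn \<phi> F `` {x}) \<le> 5"
  proof (rule min_degree_le_5[OF F])
    show "S \<subseteq> D" by (auto simp: S_def)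
    show "\<alpha> d \<in> S" if "d \<in> S" for d
      using that inv_in[of d] inv_inv[of d] by (auto simp: S_def insert_commute)
    show "(d, \<alpha> d) \<notin> conn \<phi> F" if "d \<in> S" for d
      using that comp_eq_iff[of d "\<alpha> d" F] inv_in[of d] by (simp add: S_def)
    show "d = d'" if "d \<in> S" "d' \<in> S" "(d, d') \<in> conn \<phi> F" "(\<alpha> d, \<alpha> d') \<in> conn \<phi> F" for d d'
    proof -
      have D: "d \<in> D" "d' \<in> D" using that by (auto simp: S_def)
      then have c: "?c d = ?c d'" "?c (\<alpha> d) = ?c (\<alpha> d')" using that by (auto simp: comp_eq_iff inv_in)
      then have "{d, \<alpha> d} = {d', \<alpha> d'}" using that by (auto simp: S_def)
      then have "d = d' \<or> d = \<alpha> d'" using D edge_eq_iff by blast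
      with c that show ?thesis by (auto simp: S_def)
    qed
  qed
  then obtain x where x: "x \<in> D" "card (S \<inter> conn \<phi> F `` {x}) \<le> 5" by blast
  let ?u = "?c x"
  \<comment> \<open>Every super-edge at \<open>?u\<close> is hit by the dart of its representative
    at \<open>?u\<close>, so the degree is at most the number of \<open>S\<close>-darts
    there.\<close>
  have "nbhd D \<alpha> \<sigma> F ?u \<subseteq> (\<lambda>d. super_edge D \<alpha> \<sigma> F ?u (?c (\<alpha> d))) ` (S \<inter> conn \<phi> F `` {x})"
  proof
    fix A assume "A \<in> nbhd D \<alpha> \<sigma> F ?u"
    then obtain w e where w: "A = super_edge D \<alpha> \<sigma> F ?u w" "w \<noteq> ?u" "e \<in> A" by (auto simp: nbhd_def)
    from w(3)[unfolded w(1)] obtain d where d: "d \<in> D" "e = {d, \<alpha> d}" "?c d = ?u" "?c (\<alpha> d) = w"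
      by (rule super_edgeE)
    have "rep {?u, w} \<in> E \<and> cends D \<alpha> \<sigma> F (rep {?u, w}) = {?u, w}"
      unfolding rep_def by (rule someI[of _ e]) (use d in \<open>auto simp: edge_in_E cends_edge\<close>)
    then have "rep {?u, w} \<in> super_edge D \<alpha> \<sigma> F ?u w"
      using w(2) by (auto simp: super_edge_def rem_edges_def card_insert_if)
    then obtain s where s: "s \<in> D" "rep {?u, w} = {s, \<alpha> s}" "?c s = ?u" "?c (\<alpha> s) = w"
      by (rule super_edgeE)
    then have "s \<in> S \<inter> conn \<phi> F `` {x}" using w(2) x(1) by (auto simp: S_def comp_eq_iff[symmetric])
    with s w(1) show "A \<in> (\<lambda>d. super_edge D \<alpha> \<sigma> F ?u (?c (\<alpha> d))) ` (S \<inter> conn \<phi> F `` {x})" by auto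
  qed
  moreover have "finite (S \<inter> conn \<phi> F `` {x})" 
    using finite_D by (auto simp: S_def)
  ultimately have "cdeg D \<alpha> \<sigma> F ?u \<le> card (S \<inter> conn \<phi> F `` {x})"
    unfolding cdeg_def by (rule surj_card_le[rotated])
  with x(2) have "cdeg D \<alpha> \<sigma> F ?u \<le> 5" by linarith
  with x(1) show ?thesis by (auto simp: dual_comps_eq)
qed

text \<open>Contraction turns every edge parallel to \<open>e\<close> into a loop, and as it only
  merges vertices, no loop becomes an edge again.\<close>

lemma rem_edges_insert_le:
  assumes e: "e \<in> super_edge D \<alpha> \<sigma> F u w" 
  shows "card (rem_edges D \<alpha> \<sigma> (F \<union> {e})) + card (super_edge D \<alpha> \<sigma> F u w) \<le> card (rem_edges D \<alpha> \<sigma> F)"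
proof -
  let ?A = "super_edge D \<alpha> \<sigma> F u w"
  have fin: "finite (rem_edges D \<alpha> \<sigma> F)" for F
    using rem_edges_subset finite_E by (rule finite_subset)
  have A: "?A \<subseteq> rem_edges D \<alpha> \<sigma> F" by (auto simp: super_edge_def)
  have "rem_edges D \<alpha> \<sigma> (F \<union> {e}) \<subseteq> rem_edges D \<alpha> \<sigma> F - ?A"
  proof
    fix e' assume e': "e' \<in> rem_edges D \<alpha> \<sigma> (F \<union> {e})"
    then obtain x where x: "x \<in> D" "e' = {x, \<alpha> x}" using rem_edges_subset edgeE by blast
    have mono: "comp (F \<union> {e}) a = comp (F \<union> {e}) b" if "comp F a = comp F b" "a \<in> D" "b \<in> D" for a b
      using that conn_mono[of F "F \<union> {e}" \<phi>] by (auto simp: comp_eq_iff)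
    have ne: "comp (F \<union> {e}) x \<noteq> comp (F \<union> {e}) (\<alpha> x)" using e' x by (simp add: edge_in_rem_edges_iff)
    then have "e' \<in> rem_edges D \<alpha> \<sigma> F" using mono[of x "\<alpha> x"] x inv_in[of x] by (auto simp: edge_in_rem_edges_iff)
    moreover have "e' \<notin> ?A"
    proof
      assume "e' \<in> ?A"
      then obtain d' where d': "d' \<in> D" "e' = {d', \<alpha> d'}" "comp F d' = u" "comp F (\<alpha> d') = w"
        by (rule super_edgeE)
      from e obtain d where d: "d \<in> D" "e = {d, \<alpha> d}" "comp F d = u" "comp F (\<alpha> d) = w"
        by (rule super_edgeE)
      have "comp (F \<union> {e}) d = comp (F \<union> {e}) (\<alpha> d)"
        using d conn_link[of d "F \<union> {e}" \<phi>] by (simp add: comp_eq_iff inv_in)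
      moreover have "comp (F \<union> {e}) d = comp (F \<union> {e}) d'"
        using d d' by (intro mono) auto
      moreover have "comp (F \<union> {e}) (\<alpha> d) = comp (F \<union> {e}) (\<alpha> d')"
        using d d' by (intro mono) (auto simp: inv_in)
      ultimately have "comp (F \<union> {e}) d' = comp (F \<union> {e}) (\<alpha> d')" by simp
      then have "e' \<notin> rem_edges D \<alpha> \<sigma> (F \<union> {e})" using d' by (simp add: edge_in_rem_edges_iff)
      with e' show False by simp
    qed
    ultimately show "e' \<in> rem_edges D \<alpha> \<sigma> F - ?A" by simp
  qed
  then have "card (rem_edges D \<alpha> \<sigma> (F \<union> {e})) \<le> card (rem_edges D \<alpha> \<sigma> F - ?A)"
    using fin by (intro card_mono) auto
  also have "\<dots> = card (rem_edges D \<alpha> \<sigma> F) - card ?A"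
    using A fin by (intro card_Diff_subset) (auto intro: finite_subset)
  finally show ?thesis using card_mono[OF fin A] by simp
qed

end

section \<open>The query order of DISCOVER\<close>

lemma qedge_in:
  assumes "L \<noteq> []" "\<And>l. l \<in> set L \<Longrightarrow> l \<noteq> []"
  shows "L ! (q mod length L) \<in> set L" "qedge L q \<in> set (L ! (q mod length L))"
proof -
  show "L ! (q mod length L) \<in> set L" using assms(1) by simp
  then have "L ! (q mod length L) \<noteq> []" by (rule assms(2))
  then show "qedge L q \<in> set (L ! (q mod length L))" by (simp add: qedge_def Let_def)
qed

text \<open>Super-edge \<open>i\<close> has a turn every \<open>length L\<close> queries, and its
  entry \<open>j\<close> comes up in every \<open>length (L ! i)\<close>-th of these turns.\<close>

lemma qedge_periodic:
  assumes "i < length L" "j < length (L ! i)" "q mod (length (L ! i) * length L) = j * length L + i"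
  shows "qedge L q = L ! i ! j"
proof -
  let ?k = "length L" and ?s = "length (L ! i)"
  have eq: "?k * (q div ?k mod ?s) + q mod ?k = j * ?k + i"
    using assms(3) by (simp add: mult.commute[of ?s] mod_mult2_eq)
  from assms(1) have k: "?k > 0" by auto
  have "(?k * (q div ?k mod ?s) + q mod ?k) mod ?k = (j * ?k + i) mod ?k" by (simp only: eq)
  then have i: "q mod ?k = i" using assms(1) by simp
  with eq k have "q div ?k mod ?s = j" by simp
  with i show ?thesis by (simp add: qedge_def Let_def)
qed

section \<open>The algorithm\<close>

locale planar_fp = plane_dart_system +
  fixes T :: "'a set set" and ch :: "'a set set \<Rightarrow> 'a set list list"
  assumes forest_T: "forest \<sigma> T" and conn_T: "card (D // conn \<sigma> T) = 1"
    and choices: "valid_choices D \<alpha> \<sigma> ch"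
begin

definition final :: "'a set set \<Rightarrow> bool" where
  "final F \<longleftrightarrow> card (dual_comps D \<alpha> \<sigma> F) \<le> 1"

text \<open>The invariant of the run: an inverted Yes is never wrong, so no edge of \<open>T\<close>
  is returned.\<close>

definition good :: "'a set set \<Rightarrow> bool" where
  "good F \<longleftrightarrow> forest \<phi> F \<and> F \<inter> T = {}"

abbreviation r :: "'a set set \<Rightarrow> nat" where
  "r F \<equiv> card (rem_edges D \<alpha> \<sigma> F)"

lemma T_subset: "T \<subseteq> E"
  using forest_T by (simp add: forest_def)

lemma good_empty: "good {}"
  by (simp add: good_def forest_def)

lemma choice:
  assumes "good F" "\<not> final F"
  obtains u where "u \<in> dual_comps D \<alpha> \<sigma> F" "length (ch F) \<le> 5" "ch F \<noteq> []"
    "set ` set (ch F) = nbhd D \<alpha> \<sigma> F u" "\<And>l. l \<in> set (ch F) \<Longrightarrow> distinct l \<and> l \<noteq> []"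
    "\<exists>l\<in>set (ch F). \<not> set l \<subseteq> T"
proof -
  have F: "forest \<phi> F" "F \<subseteq> E" using assms(1) by (auto simp: good_def forest_def)
  have two: "card (dual_comps D \<alpha> \<sigma> F) \<ge> 2" using assms(2) by (simp add: final_def)
  with choices F(2) have "valid_choice D \<alpha> \<sigma> F (ch F)" by (simp add: valid_choices_def)
  then obtain u where u: "u \<in> dual_comps D \<alpha> \<sigma> F" 
    "\<And>v. v \<in> dual_comps D \<alpha> \<sigma> F \<Longrightarrow> cdeg D \<alpha> \<sigma> F u \<le> cdeg D \<alpha> \<sigma> F v"
    "distinct (map set (ch F))" "set ` set (ch F) = nbhd D \<alpha> \<sigma> F u" "\<forall>l\<in>set (ch F). distinct l"
    by (auto simp: valid_choice_def)
  have "length (ch F) = card (set (map set (ch F)))" using distinct_card[OF u(3)] by simp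
  also have "\<dots> = cdeg D \<alpha> \<sigma> F u" using u(4) by (simp add: cdeg_def)
  also have "\<dots> \<le> 5" using exists_cdeg_le_5[OF F(1)] u(2) order_trans by blast
  finally have len: "length (ch F) \<le> 5" .
  have ne: "l \<noteq> []" if "l \<in> set (ch F)" for l
  proof -
    have "set l \<in> nbhd D \<alpha> \<sigma> F u" using u(4) that by blast
    then show ?thesis by (auto simp: nbhd_def)
  qed
  obtain x where x: "x \<in> D" "u = comp F x" using u(1) by (auto simp: dual_comps_eq)
  have "\<exists>y\<in>D. comp F y \<noteq> u"
  proof (rule ccontr)
    assume "\<not> ?thesis"
    then have "dual_comps D \<alpha> \<sigma> F \<subseteq> {u}" by (auto simp: dual_comps_eq)
    then have "card (dual_comps D \<alpha> \<sigma> F) \<le> card {u}" by (intro card_mono) auto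
    with two show False by simp
  qed
  then obtain y where y: "y \<in> D" "comp F y \<noteq> u" by blast
  \<comment> \<open>Otherwise a walk from \<open>x\<close> to \<open>y\<close> across edges outside
    \<open>T\<close> could never leave \<open>u\<close>.\<close>
  have "\<exists>d\<in>D. {d, \<alpha> d} \<notin> T \<and> comp F d = u \<and> comp F (\<alpha> d) \<noteq> u"
  proof (rule ccontr)
    assume n: "\<not> ?thesis"
    have "(x, y) \<in> conn \<phi> (E - T)" by (rule dual_connected[OF forest_T conn_T x(1) y(1)])
    then have "y \<in> D \<and> comp F y = u"
      unfolding conn_def
    proof (induction rule: symcl_induct)
      case refl
      then show ?case using x by simp
    next
      case (step y z)
      have \<phi>D: "\<phi> a \<in> D" if "a \<in> D" for a using bij_\<phi> that by (auto simp: bij_betw_def)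
      have same: "comp F (\<phi> a) = comp F a" if "a \<in> D" for a
        using comp_eq_iff[OF that \<phi>D[OF that], of F] conn_step[OF that, of \<phi> F] by simp
      from step.hyps(2) consider "z = \<phi> y" "y \<in> D" | "y = \<phi> z" "z \<in> D" 
        | "y \<in> darts (E - T)" "z = \<alpha> y" | "z \<in> darts (E - T)" "y = \<alpha> z"
        by (auto simp: dgraph_def)
      then show ?case
      proof cases
        case 1
        then show ?thesis using step.IH same[of y] \<phi>D[of y] by metis
      next
        case 2
        then show ?thesis using step.IH same[of z] by metis
      next
        case 3
        then have "y \<in> D" "{y, \<alpha> y} \<notin> T" by (auto simp: darts_def)
        then show ?thesis using 3 step.IH n inv_in[of y] by auto
      next
        case 4
        then have z: "z \<in> D" "{z, \<alpha> z} \<notin> T" by (auto simp: darts_def)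
        then have "{y, \<alpha> y} \<notin> T" "\<alpha> y = z" using 4 edge_inv[of z] inv_inv[of z] by auto
        then show ?thesis using z step.IH n by auto
      qed
    qed
    with y show False by simp
  qed
  then obtain d where d: "d \<in> D" "{d, \<alpha> d} \<notin> T" "comp F d = u" "comp F (\<alpha> d) \<noteq> u" by blast
  let ?A = "super_edge D \<alpha> \<sigma> F u (comp F (\<alpha> d))"
  have e: "{d, \<alpha> d} \<in> ?A" using in_super_edgeI[of d F] d by auto
  then have "?A \<in> nbhd D \<alpha> \<sigma> F u" using d inv_in by (auto simp: nbhd_def dual_comps_eq)
  then have "?A \<in> set ` set (ch F)" by (simp only: u(4))
  then obtain l where l: "l \<in> set (ch F)" "?A = set l" by (rule imageE)
  then have "\<exists>l\<in>set (ch F). \<not> set l \<subseteq> T" using e d(2) by blast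
  moreover have "ch F \<noteq> []" using l by auto
  ultimately show thesis using that[OF u(1) len _ u(4)] u(5) ne by simp
qed

lemma exists_good_period:
  assumes "good F" "\<not> final F"
  shows "\<exists>s P q\<^sub>0. good_period good T ch r F s P q\<^sub>0"
proof -
  let ?L = "ch F"
  from choice[OF assms] obtain u where u: "u \<in> dual_comps D \<alpha> \<sigma> F" "length ?L \<le> 5" "?L \<noteq> []"
    "set ` set ?L = nbhd D \<alpha> \<sigma> F u" "\<And>l. l \<in> set ?L \<Longrightarrow> distinct l \<and> l \<noteq> []"
    "\<exists>l\<in>set ?L. \<not> set l \<subseteq> T" by blast
  \<comment> \<open>Only edges outside \<open>T\<close> can be returned, so a returned edge comes
    from a list in \<open>R\<close>. Taking the shortest of these makes every possible contraction
    delete at least its length.\<close>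
  define R where "R = {l \<in> set ?L. \<not> set l \<subseteq> T}"
  have "R \<noteq> {}" using u(6) by (auto simp: R_def)
  then obtain l where l: "l \<in> R" "\<And>l'. l' \<in> R \<Longrightarrow> length l \<le> length l'"
    using ex_has_least_nat[of "\<lambda>l. l \<in> R" _ length] by blast
  then obtain i where i: "i < length ?L" "?L ! i = l" by (auto simp: R_def in_set_conv_nth)
  from l(1) obtain e where "e \<in> set l" "e \<notin> T" by (auto simp: R_def)
  then obtain j where j: "j < length l" "l ! j \<notin> T" by (auto simp: in_set_conv_nth)
  let ?k = "length ?L" and ?s = "length l"
  \<comment> \<open>Entry \<open>j\<close> of list \<open>i\<close> is first queried in round
    \<open>j\<close> at position \<open>i\<close>, and then with period
    \<open>?s * ?k\<close>.\<close>
  have "j * ?k + i < (j + 1) * ?k" using i by simp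
  also have "\<dots> \<le> ?s * ?k" using j by (intro mult_right_mono) auto
  finally have q0: "j * ?k + i < ?s * ?k" .
  have dec: "good (F \<union> {qedge ?L q}) \<and> r (F \<union> {qedge ?L q}) + ?s \<le> r F" if q: "qedge ?L q \<notin> T" for q
  proof -
    let ?e = "qedge ?L q"
    obtain l' where l': "l' \<in> set ?L" "?e \<in> set l'" using qedge_in[of ?L q] u(3,5) by blast
    then have "set l' \<in> nbhd D \<alpha> \<sigma> F u" using u(4) by blast
    then obtain w where w: "w \<noteq> u" "set l' = super_edge D \<alpha> \<sigma> F u w" by (auto simp: nbhd_def)
    with l' have e: "?e \<in> super_edge D \<alpha> \<sigma> F u w" by simp
    then obtain d where d: "d \<in> D" "?e = {d, \<alpha> d}" "comp F d = u" "comp F (\<alpha> d) = w"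
      by (rule super_edgeE)
    then have "(d, \<alpha> d) \<notin> conn \<phi> F" using w(1) comp_eq_iff[of d "\<alpha> d" F] inv_in by auto
    then have "forest \<phi> (insert {d, \<alpha> d} F)"
      using assms(1) d(1) by (intro forest_insertI) (auto simp: good_def)
    then have "good (F \<union> {?e})" using assms(1) q d(2) by (auto simp: good_def)
    moreover have "?s \<le> card (set l')"
      using l(2)[of l'] l' q u(5)[of l'] by (auto simp: R_def distinct_card)
    ultimately show ?thesis using rem_edges_insert_le[OF e] w(2) by simp
  qed
  have "good_period good T ch r F ?s (?s * ?k) (j * ?k + i)"
    unfolding good_period_def
  proof (intro conjI allI impI)
    show "?s * ?k \<le> 5 * ?s" using u(2) by simp
    show "qedge ?L q \<notin> T" if "q mod (?s * ?k) = j * ?k + i" for q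
      using qedge_periodic[of i ?L j q] i j that by simp
  qed (use q0 dec in auto)
  then show ?thesis by blast
qed

lemma good_insert:
  assumes "good F" "\<not> final F" "qedge (ch F) q \<notin> T"
  shows "good (F \<union> {qedge (ch F) q})"
  using exists_good_period[OF assms(1,2)] assms(3) unfolding good_period_def by blast

text \<open>With one dual component left, \<open>F\<close> has at least as many edges as there are
  faces, minus one. By Euler's formula this is \<open>card E - card T\<close>, so \<open>F\<close>
  fills \<open>E - T\<close>.\<close>

lemma final_good:
  assumes "good F" "final F"
  shows "E - F = T"
proof -
  have F: "F \<subseteq> E - T" "card (D // conn \<phi> F) + card F = card (D // conn \<phi> {})"
    using assms(1) by (auto simp: good_def forest_def)
  have "card (D // conn \<phi> F) \<le> 1" using assms(2) by (simp add: final_def card_dual_comps)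
  moreover have "card (E - T) + card T = card E"
    using T_subset finite_E card_mono[OF finite_E T_subset] 
    by (simp add: card_Diff_subset finite_subset)
  ultimately have "card (E - T) \<le> card F"
    using F(2) euler forest_T conn_T unfolding forest_def by linarith
  then have "F = E - T" using F(1) finite_E by (intro card_seteq) auto
  then show ?thesis using T_subset by auto
qed

lemma fp_run_good: "fp_run D \<alpha> \<sigma> T ch \<omega> n = Some s \<Longrightarrow> good (fst s)"
proof (induction n arbitrary: s)
  case (Suc n)
  from Suc.prems obtain s' where s': "fp_run D \<alpha> \<sigma> T ch \<omega> n = Some s'"
    "(if final (fst s') then Some s' else fp_step T ch \<omega> s') = Some s"
    by (auto simp: final_def split: option.splits)
  show ?case
  proof (cases "final (fst s')")
    case False
    let ?P = "\<lambda>q. dual_yes T \<omega> (snd s' + q) (qedge (ch (fst s')) q)"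
    from s' False have ex: "\<exists>q. ?P q" and s: "fst s = fst s' \<union> {qedge (ch (fst s')) (LEAST q. ?P q)}"
      by (auto simp: fp_step_def Let_def split: if_splits)
    from LeastI_ex[OF ex] have "qedge (ch (fst s')) (LEAST q. ?P q) \<notin> T" by (simp add: dual_yes_def)
    then show ?thesis unfolding s using good_insert[OF Suc.IH[OF s'(1)] False] by blast
  qed (use s' Suc.IH in auto)
qed (auto simp: good_empty)

section \<open>Termination of the run and its number of queries\<close>

lemma fp_run_stable:
  assumes "fp_run D \<alpha> \<sigma> T ch \<omega> n = Some s" "final (fst s)"
  shows "fp_run D \<alpha> \<sigma> T ch \<omega> (n + m) = Some s"
  by (induction m) (use assms in \<open>auto simp: final_def\<close>)

lemma fp_final_eq:
  assumes "fp_run D \<alpha> \<sigma> T ch \<omega> n = Some s" "final (fst s)"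
  shows "fp_final D \<alpha> \<sigma> T ch \<omega> = s"
proof -
  have dn: "fp_done D \<alpha> \<sigma> T ch \<omega> n" using assms by (auto simp: fp_done_def final_def)
  let ?n = "LEAST n. fp_done D \<alpha> \<sigma> T ch \<omega> n"
  have "fp_done D \<alpha> \<sigma> T ch \<omega> ?n" using dn by (rule LeastI)
  then obtain s' where s': "fp_run D \<alpha> \<sigma> T ch \<omega> ?n = Some s'" "final (fst s')"
    by (auto simp: fp_done_def final_def)
  have "?n \<le> n" using dn by (rule Least_le)
  then have "fp_run D \<alpha> \<sigma> T ch \<omega> n = Some s'"
    using fp_run_stable[OF s', of "n - ?n"] by simp
  with assms s' show ?thesis by (simp add: fp_final_def)
qed

text \<open>Links \<open>cost\<close>, which advances by single queries, to \<open>fp_run\<close>,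
  which advances by whole DISCOVER calls: \<open>q\<close> queries of the current call have already
  failed. A value below \<open>N\<close> shows that the truncation was not reached.\<close>

lemma fp_terminates:
  assumes "fp_run D \<alpha> \<sigma> T ch \<omega> n = Some (F, t)"
    and "\<And>q'. q' < q \<Longrightarrow> \<not> dual_yes T \<omega> (t + q') (qedge (ch F) q')"
    and "cost final T ch N F q (\<lambda>i. \<omega> (t + q + i)) < N"
  shows "\<exists>m s. fp_run D \<alpha> \<sigma> T ch \<omega> m = Some s \<and> final (fst s) \<and>
    snd s \<le> t + q + cost final T ch N F q (\<lambda>i. \<omega> (t + q + i))"
  using assms
proof (induction N arbitrary: n F t q)
  case (Suc N)
  let ?\<omega> = "\<lambda>i. \<omega> (t + q + i)"
  show ?case
  proof (cases "final F")
    case True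
    with Suc.prems(1) show ?thesis by (intro exI[of _ n] exI[of _ "(F, t)"]) auto
  next
    case False
    have good: "good F" using fp_run_good[OF Suc.prems(1)] by simp
    have ne: "ch F \<noteq> []" using choice[OF good False] by blast
    let ?P = "\<lambda>q. dual_yes T \<omega> (t + q) (qedge (ch F) q)"
    have shift: "?\<omega> \<circ> Suc = (\<lambda>i. \<omega> (t + Suc q + i))" by (auto simp: fun_eq_iff)
    show ?thesis
    proof (cases "?P q")
      case True
      then have cost: "cost final T ch (Suc N) F q ?\<omega> = 
        1 + cost final T ch N (F \<union> {qedge (ch F) q}) 0 (\<lambda>i. \<omega> ((t + q + 1) + 0 + i))"
        using False shift by (simp add: dual_yes_def)
      have least: "(LEAST q. ?P q) = q"
        using True Suc.prems(2) by (intro Least_equality) (auto simp: not_less[symmetric])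
      have "fp_run D \<alpha> \<sigma> T ch \<omega> (Suc n) = Some (F \<union> {qedge (ch F) q}, t + q + 1)"
        using Suc.prems(1) False ne True least
        by (auto simp: final_def fp_step_def Let_def)
      from Suc.IH[OF this, of 0] Suc.prems(3) show ?thesis unfolding cost by auto
    next
      case nP: False
      then have cost: "cost final T ch (Suc N) F q ?\<omega> = 
        1 + cost final T ch N F (Suc q) (\<lambda>i. \<omega> (t + Suc q + i))"
        using False shift by (auto simp: dual_yes_def)
      have "\<not> ?P q'" if "q' < Suc q" for q' using that nP Suc.prems(2) by (auto simp: less_Suc_eq)
      then have "\<exists>m s. fp_run D \<alpha> \<sigma> T ch \<omega> m = Some s \<and> final (fst s) \<and>
        snd s \<le> t + Suc q + cost final T ch N F (Suc q) (\<lambda>i. \<omega> (t + Suc q + i))"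
        by (rule Suc.IH[OF Suc.prems(1)]) (use Suc.prems(3) cost in simp_all)
      then show ?thesis unfolding cost by simp
    qed
  qed
qed simp

lemma fp_queries_le: "fp_queries D \<alpha> \<sigma> T ch \<omega> \<le> (SUP N. ennreal (real (cost final T ch N {} 0 \<omega>)))"
proof (cases "\<exists>N. cost final T ch N {} 0 \<omega> < N")
  case True
  then obtain N where N: "cost final T ch N {} 0 \<omega> < N" by blast
  then obtain m s where s: "fp_run D \<alpha> \<sigma> T ch \<omega> m = Some s" "final (fst s)"
    "snd s \<le> cost final T ch N {} 0 \<omega>"
    using fp_terminates[of \<omega> 0 "{}" 0 0 N] by auto
  have "fp_done D \<alpha> \<sigma> T ch \<omega> m" using s by (auto simp: fp_done_def final_def)
  then have "fp_queries D \<alpha> \<sigma> T ch \<omega> = ennreal (real (snd s))"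
    using fp_final_eq[OF s(1,2)] by (auto simp: fp_queries_def ennreal_of_nat_eq_real_of_nat)
  also have "\<dots> \<le> ennreal (real (cost final T ch N {} 0 \<omega>))" using s(3) by (intro ennreal_leI) simp
  also have "\<dots> \<le> (SUP N. ennreal (real (cost final T ch N {} 0 \<omega>)))" by (rule SUP_upper) simp
  finally show ?thesis .
next
  case False
  \<comment> \<open>If no truncated run stops early, each makes at least \<open>N\<close> queries
    and the bound is infinite.\<close>
  have "(SUP N. of_nat N :: ennreal) \<le> (SUP N. ennreal (real (cost final T ch N {} 0 \<omega>)))"
  proof (rule SUP_mono)
    fix N
    have "N \<le> cost final T ch N {} 0 \<omega>" using False by (meson not_le)
    then show "\<exists>M\<in>UNIV. (of_nat N :: ennreal) \<le> ennreal (real (cost final T ch M {} 0 \<omega>))"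
      by (intro bexI[of _ N]) (auto simp: ennreal_of_nat_eq_real_of_nat)
  qed
  then have "(SUP N. ennreal (real (cost final T ch N {} 0 \<omega>))) = top"
    by (simp only: ennreal_SUP_of_nat_eq_top top_unique)
  then show ?thesis by (simp only: top_greatest)
qed

text \<open>Monotone convergence passes from truncated runs to the full one; the initial potential
  counts the dual edges that are not loops.\<close>

lemma nn_integral_cost_le:
  assumes p: "0 \<le> p" "p < 1"
  shows "(\<integral>\<^sup>+\<omega>. (SUP N. ennreal (real (cost final T ch N {} 0 \<omega>))) \<partial>noise p) \<le> ennreal (5 / (1 - p)) * of_nat (card E)"
proof -
  have mono: "cost final T ch N F q \<omega> \<le> cost final T ch (Suc N) F q \<omega>" for N F q \<omega>
  proof (induction N arbitrary: F q \<omega>)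
    case (Suc N)
    have "cost final T ch (Suc N) F q \<omega> = (if final F then 0 else
     1 + (if qedge (ch F) q \<notin> T \<and> \<not> \<omega> 0 then cost final T ch N (F \<union> {qedge (ch F) q}) 0 (\<omega> \<circ> Suc)
          else cost final T ch N F (Suc q) (\<omega> \<circ> Suc)))" by simp
    also have "\<dots> \<le> (if final F then 0 else
     1 + (if qedge (ch F) q \<notin> T \<and> \<not> \<omega> 0 then cost final T ch (Suc N) (F \<union> {qedge (ch F) q}) 0 (\<omega> \<circ> Suc)
          else cost final T ch (Suc N) F (Suc q) (\<omega> \<circ> Suc)))"
      using Suc by (simp del: cost.simps)
    also have "\<dots> = cost final T ch (Suc (Suc N)) F q \<omega>" by (rule cost.simps(2)[symmetric])
    finally show ?case .
  qed simp
  have [measurable]: "cost final T ch N {} 0 \<in> measurable (noise p) (count_space UNIV)" for N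
    by (rule measurable_cost)
  have "(\<integral>\<^sup>+\<omega>. (SUP N. ennreal (real (cost final T ch N {} 0 \<omega>))) \<partial>noise p) 
     = (SUP N. \<integral>\<^sup>+\<omega>. ennreal (real (cost final T ch N {} 0 \<omega>)) \<partial>noise p)"
  proof (rule nn_integral_monotone_convergence_SUP)
    show "incseq (\<lambda>N \<omega>. ennreal (real (cost final T ch N {} 0 \<omega>)))"
      using mono by (intro incseq_SucI le_funI ennreal_leI) simp
  qed measurable
  also have "\<dots> \<le> ennreal (5 / (1 - p)) * of_nat (card E)"
  proof (rule SUP_least)
    fix N
    have "expcost p final T ch N {} 0 \<le> 5 / (1 - p) * real (r {})"
      by (rule expcost_le[OF p exists_good_period good_empty])
    also have "\<dots> \<le> 5 / (1 - p) * real (card E)"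
      using p card_mono[OF finite_E rem_edges_subset, of "{}"] by (intro mult_left_mono) auto
    finally have "ennreal (expcost p final T ch N {} 0) \<le> ennreal (5 / (1 - p) * real (card E))"
      by (rule ennreal_leI)
    also have "\<dots> = ennreal (5 / (1 - p)) * of_nat (card E)"
      using p by (subst ennreal_mult) (auto simp: ennreal_of_nat_eq_real_of_nat)
    finally show "(\<integral>\<^sup>+\<omega>. ennreal (real (cost final T ch N {} 0 \<omega>)) \<partial>noise p) 
        \<le> ennreal (5 / (1 - p)) * of_nat (card E)"
      using p by (subst nn_integral_cost) auto
  qed
  finally show ?thesis .
qed

lemma fp_correct:
  assumes p: "0 \<le> p" "p < 1"
  shows "AE \<omega> in noise p. fp_output D \<alpha> \<sigma> T ch \<omega> = Some T"
    and "(\<integral>\<^sup>+ \<omega>. fp_queries D \<alpha> \<sigma> T ch \<omega> \<partial>noise p) \<le> ennreal (5 / (1 - p)) * of_nat (card E)"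
proof -
  \<comment> \<open>\<open>?g\<close> is a measurable majorant of the number of queries; the bound
    on its integral yields both claims.\<close>
  let ?g = "\<lambda>\<omega>. SUP N. ennreal (real (cost final T ch N {} 0 \<omega>))"
  have "(\<integral>\<^sup>+ \<omega>. fp_queries D \<alpha> \<sigma> T ch \<omega> \<partial>noise p) \<le> integral\<^sup>N (noise p) ?g"
    by (rule nn_integral_mono) (rule fp_queries_le)
  also note nn_integral_cost_le[OF p]
  finally show "(\<integral>\<^sup>+ \<omega>. fp_queries D \<alpha> \<sigma> T ch \<omega> \<partial>noise p) \<le> ennreal (5 / (1 - p)) * of_nat (card E)" .
  have [measurable]: "cost final T ch N {} 0 \<in> measurable (noise p) (count_space UNIV)" for N
    by (rule measurable_cost)
  have "integral\<^sup>N (noise p) ?g < \<infinity>"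
    using nn_integral_cost_le[OF p] by (rule le_less_trans) (simp add: ennreal_mult_less_top of_nat_less_top)
  then have "AE \<omega> in noise p. ?g \<omega> \<noteq> \<infinity>"
    by (intro nn_integral_PInf_AE) auto
  then show "AE \<omega> in noise p. fp_output D \<alpha> \<sigma> T ch \<omega> = Some T"
  proof eventually_elim
    case (elim \<omega>)
    with fp_queries_le[of \<omega>] have "fp_queries D \<alpha> \<sigma> T ch \<omega> \<noteq> \<infinity>"
      by (metis infinity_ennreal_def top_unique)
    then have ex: "\<exists>n. fp_done D \<alpha> \<sigma> T ch \<omega> n" by (auto simp: fp_queries_def split: if_splits)
    then obtain n s where s: "fp_run D \<alpha> \<sigma> T ch \<omega> n = Some s" "final (fst s)"
      by (auto simp: fp_done_def final_def)
    then show ?case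
      using ex fp_final_eq[OF s] final_good[OF fp_run_good[OF s(1)] s(2)] by (simp add: fp_output_def)
  qed
qed

end

section \<open>From the combinatorial definitions to the locales\<close>

lemma planar_fpI:
  assumes "plane_map D \<alpha> \<sigma>" "spanning_tree D \<alpha> \<sigma> T" "valid_choices D \<alpha> \<sigma> ch"
  shows "planar_fp D \<alpha> \<sigma> T ch"
proof -
  have map: "is_map D \<alpha> \<sigma>" using assms(1) by (simp add: plane_map_def)
  interpret dart_system D \<alpha>
    using map by unfold_locales (auto simp: is_map_def)
  have bij_\<sigma>: "bij_betw \<sigma> D D" using map by (simp add: is_map_def)
  have bij_\<phi>: "bij_betw (\<sigma> \<circ> \<alpha>) D D" using bij_inv bij_\<sigma> by (rule bij_betw_trans)
  have verts: "card (map_verts D \<sigma>) = card (D // conn \<sigma> {})"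
    by (simp add: map_verts_def card_orbits[OF finite_D bij_\<sigma>] conn_empty)
  have faces: "card (map_faces D \<alpha> \<sigma>) = card (D // conn (\<sigma> \<circ> \<alpha>) {})"
    by (simp add: map_faces_def card_orbits[OF finite_D bij_\<phi>] conn_empty)
  interpret plane_dart_system D \<alpha> \<sigma>
    using assms(1) bij_\<sigma> verts faces by unfold_locales (auto simp: plane_map_def)
  obtain x where x: "x \<in> D" using D_nonempty by blast
  have "conn \<sigma> T `` {y} = conn \<sigma> T `` {x}" if "y \<in> D" for y
    unfolding conn_Image_eq_iff
    using assms(2) orbit_path_iff[OF bij_\<sigma> that x, of T] x that by (auto simp: spanning_tree_def map_verts_def)
  then have "D // conn \<sigma> T = {conn \<sigma> T `` {x}}"
    using x unfolding quotient_def by blast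
  then have one: "card (D // conn \<sigma> T) = 1" by simp
  have "forest \<sigma> T"
    using assms(2) one verts by (simp add: forest_def spanning_tree_def)
  with one assms(3) show ?thesis by unfold_locales
qed

theorem theorem5:
  fixes p :: real
  assumes "0 \<le> p" and "p < 1/2"
  shows "\<exists>C::real. \<forall>(D::nat set) \<alpha> \<sigma> T ch.
     plane_map D \<alpha> \<sigma> \<and> simple_map D \<alpha> \<sigma> \<and> spanning_tree D \<alpha> \<sigma> T \<and> valid_choices D \<alpha> \<sigma> ch \<longrightarrow>
       (AE \<omega> in noise p. fp_output D \<alpha> \<sigma> T ch \<omega> = Some T) \<and>
       (\<integral>\<^sup>+ \<omega>. fp_queries D \<alpha> \<sigma> T ch \<omega> \<partial>noise p) \<le> ennreal C * of_nat (card (map_edges D \<alpha>))"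
proof (intro exI[of _ "5 / (1 - p)"] allI impI)
  fix D :: "nat set" and \<alpha> \<sigma> T ch
  assume "plane_map D \<alpha> \<sigma> \<and> simple_map D \<alpha> \<sigma> \<and> spanning_tree D \<alpha> \<sigma> T \<and> valid_choices D \<alpha> \<sigma> ch"
  then interpret planar_fp D \<alpha> \<sigma> T ch
    by (intro planar_fpI) auto
  show "(AE \<omega> in noise p. fp_output D \<alpha> \<sigma> T ch \<omega> = Some T) \<and>
       (\<integral>\<^sup>+ \<omega>. fp_queries D \<alpha> \<sigma> T ch \<omega> \<partial>noise p) \<le> ennreal (5 / (1 - p)) * of_nat (card (map_edges D \<alpha>))"
    using fp_correct[of p] assms by simp
qed

end
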